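(* For every odd positive integer $k$ there exists a simple arrangement of $5k$ lines in the Euclidean plane, $3k$ of them colored red and $2k$ colored blue, in which every alternating dual path has length at most $14k$.
   Context: A line arrangement is simple if no two lines are parallel and no point lies on three or more lines. The lines partition the plane into vertices, edges (maximal segments/rays of lines containing no vertex) and faces. Each edge receives the color of the line containing it. A dual path is a sequence of faces such that any two consecutive faces share an edge and no face appears more than once; its length is the number of faces. A dual path $f_1,f_2,\dots,f_m$ is alternating if, letting $e_j$ be the edge shared by $f_j$ and $f_{j+1}$, no two consecutive edges $e_j,e_{j+1}$ have the same color. *)

theory Defs
  imports "HOL-Analysis.Analysis"
begin

type_synonym plane = "real ^ 2"

datatype color = Red | Blue

definition is_line :: "plane set \<Rightarrow> bool" where
  "is_line l \<longleftrightarrow> affine l \<and> aff_dim l = 1"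

definition line_arrangement :: "plane set set \<Rightarrow> bool" where
  "line_arrangement A \<longleftrightarrow> finite A \<and> (\<forall>l\<in>A. is_line l)"

definition simple_arrangement :: "plane set set \<Rightarrow> bool" where
  "simple_arrangement A \<longleftrightarrow>
     line_arrangement A \<and>
     pairwise (\<lambda>l m. \<not> affine_parallel l m) A \<and>
     (\<forall>p. card {l \<in> A. p \<in> l} \<le> 2)"

definition vertices :: "plane set set \<Rightarrow> plane set" where
  "vertices A = {p. \<exists>l\<in>A. \<exists>m\<in>A. l \<noteq> m \<and> p \<in> l \<and> p \<in> m}"

(* Edges are relatively open: a connected component of a line minus the vertices is
   a maximal segment or ray of that line containing no vertex. *)
definition edges :: "plane set set \<Rightarrow> plane set set" where
  "edges A = (\<Union>l\<in>A. components (l - vertices A))"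

definition faces :: "plane set set \<Rightarrow> plane set set" where
  "faces A = components (- \<Union>A)"

definition edge_color :: "(plane set \<Rightarrow> color) \<Rightarrow> plane set set \<Rightarrow> plane set \<Rightarrow> color" where
  "edge_color c A e = c (THE l. l \<in> A \<and> e \<subseteq> l)"

definition shared_edge :: "plane set set \<Rightarrow> plane set \<Rightarrow> plane set \<Rightarrow> plane set \<Rightarrow> bool" where
  "shared_edge A f g e \<longleftrightarrow> e \<in> edges A \<and> e \<subseteq> frontier f \<and> e \<subseteq> frontier g"

definition dual_path :: "plane set set \<Rightarrow> plane set list \<Rightarrow> bool" where
  "dual_path A fs \<longleftrightarrow>
     fs \<noteq> [] \<and> set fs \<subseteq> faces A \<and> distinct fs \<and>
     successively (\<lambda>f g. \<exists>e. shared_edge A f g e) fs"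

(* es lists the edges crossed by the path. Two distinct faces are convex and share at
   most one edge, so es is determined by fs. *)
definition alternating_dual_path ::
  "(plane set \<Rightarrow> color) \<Rightarrow> plane set set \<Rightarrow> plane set list \<Rightarrow> bool" where
  "alternating_dual_path c A fs \<longleftrightarrow>
     dual_path A fs \<and>
     (\<exists>es. length fs = Suc (length es) \<and>
           (\<forall>j < length es. shared_edge A (fs ! j) (fs ! Suc j) (es ! j)) \<and>
           successively (\<lambda>e e'. edge_color c A e \<noteq> edge_color c A e') es)"

end

theory Submission
  imports Defs
begin

text \<open>
  Put \<open>n = 3k\<close> and \<open>h = \<pi>/n\<close>. The red lines are the tangents of the unit circle at the angles
  \<open>2hi\<close>, i.e. the extended sides of a regular \<open>n\<close>-gon. The blue lines are almost diameters, namely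
  tangents of a tiny concentric circle; outside the unit circle they form \<open>4k\<close> rays, two of which
  lie in each angular cell \<open>(3qh, (3q+1)h)\<close>, \<open>q < 2k\<close>. A face is given by the set \<open>X\<close> of red and the
  set \<open>Y\<close> of blue lines on whose positive side it lies. Along an alternating path the parities of
  \<open>|X|\<close> and \<open>|Y|\<close> have period four, so every fourth face has both of them odd; such a face lies
  between the two blue rays of one cell and is determined by the cell and by \<open>|X|\<close>. From one of these
  faces to the next \<open>|X|\<close> changes by at most two, and the cell can only change if both have \<open>|X| = 1\<close>.
  They thus form a comb with \<open>2k\<close> teeth along which the path enters by one tooth and leaves by another
  one, and as \<open>|X| \<le> (n + 1) / 2\<close> the teeth are too short for a path with more than \<open>14k\<close> faces.
\<close>

subsection \<open>Sign vectors of families of hyperplanes\<close>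

text \<open>What keeps a path inside its cell: in units of \<open>h\<close>, the symmetry axes of
  the red polygon are the integer angles, and consecutive cells leave a gap
  \<open>[3q - 2, 3q]\<close> of width two. To hop across, the path makes one red crossing at a
  point \<open>Q\<close> of the sector joining the two cells. Wherever \<open>Q\<close> lies, two
  consecutive axes separate it from one of the cells. The lines seen from that cell would then be
  invariant under both reflections, so all red lines would be seen at once, which is impossible.
  Hence one cell per three units, and the ratio of \<open>3k\<close> red to \<open>2k\<close> blue
  lines.

  The count: at most \<open>2k\<close> faces with \<open>|X| = 1\<close>, one per cell, and at most
  two for each larger odd value of \<open>|X|\<close> up to about \<open>3k/2\<close>. That is about
  \<open>2k + 3k/2\<close> special faces, and four times this is \<open>14k\<close>. If
  \<open>3k mod 4 = 1\<close>, the plain estimate gives \<open>14k + 1\<close>, so the extremal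
  walks in the comb have to be examined.\<close>

definition hyperplane :: "'a::euclidean_space \<Rightarrow> real \<Rightarrow> 'a set" where
  "hyperplane a b = {x. a \<bullet> x = b}"

definition pos_set :: "'i set \<Rightarrow> ('i \<Rightarrow> 'a::euclidean_space) \<Rightarrow> ('i \<Rightarrow> real) \<Rightarrow> 'a \<Rightarrow> 'i set" where
  "pos_set I a b x = {i \<in> I. a i \<bullet> x > b i}"

text \<open>By the intermediate value theorem, a connected set with points on both sides of a
  hyperplane meets it.\<close>

lemma pos_set_eq_on_component:
  assumes "f \<in> components (- (\<Union>i\<in>I. hyperplane (a i) (b i)))" "x \<in> f" "y \<in> f"
  shows "pos_set I a b x = pos_set I a b y"
proof -
  have conn: "connected f" and sub: "f \<subseteq> - (\<Union>i\<in>I. hyperplane (a i) (b i))"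
    using assms(1) by (auto dest: in_components_connected in_components_subset)
  have side: "a i \<bullet> v > b i" if uv: "i \<in> I" "a i \<bullet> u > b i" "u \<in> f" "v \<in> f" for i u v
  proof (rule ccontr)
    assume "\<not> a i \<bullet> v > b i"
    then obtain z where "z \<in> f" "a i \<bullet> z = b i"
      using connected_ivt_hyperplane[OF conn uv(4,3), of "a i" "b i"] uv(2) by force
    then show False using sub uv(1) by (auto simp: hyperplane_def)
  qed
  show ?thesis using side assms(2,3) by (auto simp: pos_set_def)
qed

text \<open>The open half-spaces selected by a sign vector intersect in a convex set that avoids all
  hyperplanes, so it fits into one component. Faces may therefore be replaced by their sign
  vectors.\<close>

lemma component_eq_if_pos_set_eq:
  fixes a :: "'i \<Rightarrow> 'a::euclidean_space"
  assumes f: "f \<in> components (- (\<Union>i\<in>I. hyperplane (a i) (b i)))" "x \<in> f"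
    and g: "g \<in> components (- (\<Union>i\<in>I. hyperplane (a i) (b i)))" "y \<in> g"
    and eq: "pos_set I a b x = pos_set I a b y"
  shows "f = g"
proof -
  let ?S = "- (\<Union>i\<in>I. hyperplane (a i) (b i))"
  define H where "H i = (if a i \<bullet> x > b i then {z. a i \<bullet> z > b i} else {z. a i \<bullet> z < b i})" for i
  define C where "C = (\<Inter>i\<in>I. H i)"
  have "convex C"
    unfolding C_def H_def by (intro convex_INT) (simp add: convex_halfspace_gt convex_halfspace_lt)
  moreover have "z \<notin> hyperplane (a i) (b i)" if "z \<in> C" "i \<in> I" for z i
  proof -
    have "z \<in> H i" using that by (auto simp: C_def)
    then show ?thesis by (auto simp: H_def hyperplane_def split: if_splits)
  qed
  then have "C \<subseteq> ?S" by blast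
  moreover have "x \<in> ?S" "y \<in> ?S" using f g in_components_subset by blast+
  then have off: "a i \<bullet> x \<noteq> b i" "a i \<bullet> y \<noteq> b i" if "i \<in> I" for i
    using that by (auto simp: hyperplane_def)
  have same: "a i \<bullet> x > b i \<longleftrightarrow> a i \<bullet> y > b i" if "i \<in> I" for i
    using eq that by (auto simp: pos_set_def)
  have "x \<in> H i \<and> y \<in> H i" if "i \<in> I" for i
    using off[OF that] same[OF that] by (auto simp: H_def)
  then have "x \<in> C" "y \<in> C" by (auto simp: C_def)
  ultimately have "C \<subseteq> f" "C \<subseteq> g"
    using f g components_maximal[of f ?S C] components_maximal[of g ?S C] convex_connected by auto
  then show ?thesis using \<open>x \<in> C\<close> f(1) g(1) components_eq by blast
qed

text \<open>The witness \<open>q\<close> is a point of the crossed edge. It is recorded, besides the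
  toggling of \<open>i\<close>, because the later geometric argument depends on where the edge
  lies.\<close>

definition crossing ::
  "'i set \<Rightarrow> ('i \<Rightarrow> 'a::euclidean_space) \<Rightarrow> ('i \<Rightarrow> real) \<Rightarrow> 'i \<Rightarrow> 'a \<Rightarrow> 'a \<Rightarrow> bool" where
  "crossing I a b i x y \<longleftrightarrow> i \<in> I \<and> (i \<in> pos_set I a b x \<longleftrightarrow> i \<notin> pos_set I a b y) \<and>
     (\<exists>q. a i \<bullet> q = b i \<and> (\<forall>j\<in>I. j \<noteq> i \<longrightarrow> a j \<bullet> q \<noteq> b j) \<and>
        pos_set I a b x - {i} = pos_set I a b q \<and> pos_set I a b y - {i} = pos_set I a b q)"

text \<open>A whole neighbourhood of \<open>q\<close> lies on the same side as \<open>q\<close> of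
  every hyperplane except number \<open>i\<close>, and it meets \<open>f\<close>.\<close>

lemma pos_set_near_frontier:
  fixes a :: "'i \<Rightarrow> 'a::euclidean_space"
  assumes "finite I" and f: "f \<in> components (- (\<Union>i\<in>I. hyperplane (a i) (b i)))" "x \<in> f"
    and q: "q \<in> frontier f" "\<forall>j\<in>I. j \<noteq> i \<longrightarrow> a j \<bullet> q \<noteq> b j" "a i \<bullet> q = b i"
  shows "pos_set I a b x - {i} = pos_set I a b q"
proof -
  define H where "H j = (if a j \<bullet> q > b j then {z. a j \<bullet> z > b j} else {z. a j \<bullet> z < b j})" for j
  define U where "U = (\<Inter>j\<in>I - {i}. H j)"
  have "open U"
    unfolding U_def H_def using \<open>finite I\<close>
    by (intro open_INT) (auto simp: open_halfspace_gt open_halfspace_lt)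
  moreover have "q \<in> U" using q(2) by (force simp: U_def H_def)
  moreover have "q \<in> closure f" using q(1) by (simp add: frontier_def)
  ultimately obtain z where z: "z \<in> f" "z \<in> U"
    by (meson disjoint_iff open_Int_closure_eq_empty)
  have "pos_set I a b x = pos_set I a b z"
    using pos_set_eq_on_component[OF f(1,2) z(1)] .
  moreover have "a j \<bullet> z > b j \<longleftrightarrow> a j \<bullet> q > b j" if "j \<in> I" "j \<noteq> i" for j
  proof -
    have "z \<in> H j" using z(2) that by (auto simp: U_def)
    then show ?thesis by (auto simp: H_def split: if_splits)
  qed
  then have "j \<in> pos_set I a b z - {i} \<longleftrightarrow> j \<in> pos_set I a b q" for j
    using q(3) by (cases "j = i") (auto simp: pos_set_def)
  then have "pos_set I a b z - {i} = pos_set I a b q" by blast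
  ultimately show ?thesis by simp
qed

text \<open>A point of the edge is no vertex, so it lies on a single line. Both sign vectors agree
  with that of the point off this line, and distinct faces must then differ on it.\<close>

lemma shared_edge_crossing:
  fixes a :: "'i \<Rightarrow> plane"
  assumes I: "finite I" "inj_on (\<lambda>i. hyperplane (a i) (b i)) I"
    and A: "A = (\<lambda>i. hyperplane (a i) (b i)) ` I"
    and f: "f \<in> faces A" "x \<in> f" and g: "g \<in> faces A" "y \<in> g" and "f \<noteq> g"
    and e: "shared_edge A f g e"
  shows "\<exists>i. crossing I a b i x y \<and> edge_color c A e = c (hyperplane (a i) (b i))"
proof -
  let ?H = "\<lambda>i. hyperplane (a i) (b i)"
  have faces: "faces A = components (- (\<Union>i\<in>I. ?H i))" by (simp add: faces_def A)
  obtain i where i: "i \<in> I" "e \<in> components (?H i - vertices A)"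
    using e by (auto simp: shared_edge_def edges_def A)
  then obtain q where q: "q \<in> e" using in_components_nonempty by blast
  have eH: "e \<subseteq> ?H i - vertices A" using i in_components_subset by blast
  then have qi: "a i \<bullet> q = b i" using q by (auto simp: hyperplane_def)
  have only: "?H j = ?H i" if "j \<in> I" "q \<in> ?H j" for j
    using eH q i(1) that unfolding vertices_def A by blast
  then have off: "\<forall>j\<in>I. j \<noteq> i \<longrightarrow> a j \<bullet> q \<noteq> b j"
    using inj_onD[OF I(2) only] i(1) by (auto simp: hyperplane_def)
  have "pos_set I a b x - {i} = pos_set I a b q" "pos_set I a b y - {i} = pos_set I a b q"
    using e q pos_set_near_frontier[OF I(1) f[unfolded faces] _ off qi]
      pos_set_near_frontier[OF I(1) g[unfolded faces] _ off qi]
    unfolding shared_edge_def by blast+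
  moreover have "pos_set I a b x \<noteq> pos_set I a b y"
    using component_eq_if_pos_set_eq f g \<open>f \<noteq> g\<close> unfolding faces by blast
  ultimately have "crossing I a b i x y"
    unfolding crossing_def using i(1) qi off by blast
  moreover have "(THE l. l \<in> A \<and> e \<subseteq> l) = ?H i"
  proof (rule the_equality)
    show "?H i \<in> A \<and> e \<subseteq> ?H i" using eH i(1) by (auto simp: A)
    show "l = ?H i" if "l \<in> A \<and> e \<subseteq> l" for l using that only q by (auto simp: A)
  qed
  then have "edge_color c A e = c (?H i)" by (simp add: edge_color_def)
  ultimately show ?thesis by blast
qed

lemma alternating_dual_path_crossings:
  fixes a :: "'i \<Rightarrow> plane"
  assumes I: "finite I" "inj_on (\<lambda>i. hyperplane (a i) (b i)) I"
    and A: "A = (\<lambda>i. hyperplane (a i) (b i)) ` I"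
    and fs: "alternating_dual_path c A fs"
  obtains p w where
    "\<And>i j. i < j \<Longrightarrow> j < length fs \<Longrightarrow> pos_set I a b (p i) \<noteq> pos_set I a b (p j)"
    "\<And>j. Suc j < length fs \<Longrightarrow> crossing I a b (w j) (p j) (p (Suc j))"
    "\<And>j. Suc (Suc j) < length fs \<Longrightarrow>
        c (hyperplane (a (w j)) (b (w j))) \<noteq> c (hyperplane (a (w (Suc j))) (b (w (Suc j))))"
proof -
  obtain es where len: "length fs = Suc (length es)"
    and edge: "\<And>j. j < length es \<Longrightarrow> shared_edge A (fs ! j) (fs ! Suc j) (es ! j)"
    and alt: "successively (\<lambda>e e'. edge_color c A e \<noteq> edge_color c A e') es"
    and sub: "set fs \<subseteq> faces A" and dist: "distinct fs"
    using fs unfolding alternating_dual_path_def dual_path_def by blast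
  have face: "fs ! j \<in> faces A" if "j < length fs" for j using sub that by auto
  have ne: "fs ! j \<noteq> {}" if "j < length fs" for j
    using face[OF that] in_components_nonempty unfolding faces_def by blast
  define p where "p j = (SOME x. x \<in> fs ! j)" for j
  have p: "p j \<in> fs ! j" if "j < length fs" for j
    using ne[OF that] unfolding p_def by (simp add: some_in_eq)
  have faces: "faces A = components (- (\<Union>i\<in>I. hyperplane (a i) (b i)))" by (simp add: faces_def A)
  have "\<exists>i. crossing I a b i (p j) (p (Suc j)) \<and>
        edge_color c A (es ! j) = c (hyperplane (a i) (b i))" if "Suc j < length fs" for j
    using that len dist
    by (intro shared_edge_crossing[OF I A face[of j] p[of j] face[of "Suc j"] p[of "Suc j"] _ edge])
      (simp_all add: nth_eq_iff_index_eq)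
  then obtain w where w: "\<And>j. Suc j < length fs \<Longrightarrow> crossing I a b (w j) (p j) (p (Suc j))"
    "\<And>j. Suc j < length fs \<Longrightarrow> edge_color c A (es ! j) = c (hyperplane (a (w j)) (b (w j)))"
    by metis
  show thesis
  proof
    show "pos_set I a b (p i) \<noteq> pos_set I a b (p j)" if "i < j" "j < length fs" for i j
    proof
      assume "pos_set I a b (p i) = pos_set I a b (p j)"
      then have "fs ! i = fs ! j"
        using component_eq_if_pos_set_eq[of "fs ! i" a b I "p i" "fs ! j" "p j"] p face that
        unfolding faces by simp
      then show False using that dist by (simp add: nth_eq_iff_index_eq)
    qed
    show "crossing I a b (w j) (p j) (p (Suc j))" if "Suc j < length fs" for j
      using w(1) that .
    show "c (hyperplane (a (w j)) (b (w j))) \<noteq> c (hyperplane (a (w (Suc j))) (b (w (Suc j))))"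
      if "Suc (Suc j) < length fs" for j
      using alt w(2)[of j] w(2)[of "Suc j"] that len by (auto simp: successively_conv_nth)
  qed
qed

subsection \<open>Lines in polar coordinates\<close>

definition dirv :: "real \<Rightarrow> plane" where
  "dirv t = vector [cos t, sin t]"

lemma inner_dirv: "dirv s \<bullet> dirv t = cos (s - t)"
  by (simp add: dirv_def inner_vec_def sum_2 cos_diff)

lemma dirv_nonzero: "dirv t \<noteq> 0"
  using inner_dirv[of t t] by auto

lemma exists_polar:
  obtains r t where "r \<ge> 0" "w < t" "t \<le> w + 2 * pi" "(P :: plane) = r *\<^sub>R dirv t"
proof -
  define r where "r = sqrt ((P$1)\<^sup>2 + (P$2)\<^sup>2)"
  have "\<exists>t. P = r *\<^sub>R dirv t"
  proof (cases "r = 0")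
    case True
    then have "P = 0" by (simp add: r_def vec_eq_iff forall_2 sum_power2_eq_zero_iff)
    then show ?thesis by (simp add: True)
  next
    case False
    then have "(P$1 / r)\<^sup>2 + (P$2 / r)\<^sup>2 = 1"
      by (simp add: power_divide r_def flip: add_divide_distrib)
    then obtain t where "P$1 / r = cos t" "P$2 / r = sin t" using sincos_total_2pi by metis
    then have "P = r *\<^sub>R dirv t"
      using False by (simp add: vec_eq_iff forall_2 dirv_def field_simps)
    then show ?thesis by blast
  qed
  then obtain t where t: "P = r *\<^sub>R dirv t" by blast
  define m where "m = \<lceil>(t - w) / (2 * pi)\<rceil> - 1"
  have "of_int m < (t - w) / (2 * pi)" "(t - w) / (2 * pi) \<le> of_int m + 1"
    unfolding m_def by linarith+
  then have "w < t - 2 * pi * of_int m" "t - 2 * pi * of_int m \<le> w + 2 * pi"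
    by (simp_all add: field_simps)
  moreover have "dirv (t - 2 * pi * of_int m) = dirv t"
    by (simp add: dirv_def cos_diff sin_diff)
  moreover have "r \<ge> 0" by (simp add: r_def)
  ultimately show thesis using that t by metis
qed

lemma is_line_hyperplane_dirv: "is_line (hyperplane (dirv t) b)"
  using dirv_nonzero[of t] affine_hyperplane[of "dirv t" b]
  by (simp add: is_line_def hyperplane_def aff_dim_hyperplane)

lemma not_affine_parallel_hyperplane_dirv:
  assumes "sin (s - t) \<noteq> 0"
  shows "\<not> affine_parallel (hyperplane (dirv s) a) (hyperplane (dirv t) b)"
proof
  assume "affine_parallel (hyperplane (dirv s) a) (hyperplane (dirv t) b)"
  then obtain c where c: "hyperplane (dirv t) b = (+) c ` hyperplane (dirv s) a"
    by (auto simp: affine_parallel_def)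
  define x where "x = a *\<^sub>R dirv s"
  \<comment> \<open>\<open>dirv (s + pi/2)\<close> is a direction of the first line. A translation
    preserves it, so it must be orthogonal to the second normal.\<close>
  have "x \<in> hyperplane (dirv s) a" "x + dirv (s + pi/2) \<in> hyperplane (dirv s) a"
    by (simp_all add: hyperplane_def x_def inner_dirv inner_add_right)
  then have "c + x \<in> hyperplane (dirv t) b" "c + (x + dirv (s + pi/2)) \<in> hyperplane (dirv t) b"
    using c by blast+
  then have "dirv t \<bullet> dirv (s + pi/2) = 0"
    by (simp add: hyperplane_def inner_add_right)
  moreover have "cos (t - (s + pi/2)) = - sin (s - t)"
    by (simp add: cos_diff sin_diff cos_add sin_add)
  ultimately show False using assms by (simp add: inner_dirv)
qed

subsection \<open>Walks in a comb\<close>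

text \<open>\<open>Z t\<close> is the tooth visited at time \<open>t\<close> and \<open>d t\<close> the depth in it; all the places with \<open>d t = 1\<close> may be
  adjacent. The walk cannot turn around inside a tooth, so it first descends and finally ascends.\<close>

lemma comb_walk_length:
  fixes d :: "nat \<Rightarrow> nat" and Z :: "nat \<Rightarrow> 'z"
  assumes odd: "\<And>t. t < N \<Longrightarrow> odd (d t)"
    and inj: "\<And>s t. s < t \<Longrightarrow> t < N \<Longrightarrow> d s = d t \<Longrightarrow> Z s \<noteq> Z t"
    and step: "\<And>t. Suc t < N \<Longrightarrow> d t \<ge> 3 \<or> d (Suc t) \<ge> 3 \<Longrightarrow>
      Z (Suc t) = Z t \<and> d (Suc t) \<le> d t + 2 \<and> d t \<le> d (Suc t) + 2"
    and max: "\<And>t. t < N \<Longrightarrow> d t \<le> 2 * E + 1"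
    and base: "card (Z ` {t. t < N \<and> d t = 1}) \<le> M"
  shows "N \<le> M + 2 * E"
    and "N = M + 2 * E \<Longrightarrow> E \<ge> 1 \<Longrightarrow>
      \<exists>t. N = Suc (Suc t) \<and> d t + 2 = 2 * E + 1 \<and> d (Suc t) = 2 * E + 1 \<and> Z t = Z (Suc t)"
proof -
  have step2: "Z (Suc t) = Z t \<and> (d (Suc t) = d t + 2 \<or> d t = d (Suc t) + 2)"
    if "Suc t < N" "d t \<ge> 3 \<or> d (Suc t) \<ge> 3" for t
  proof -
    have "d t \<noteq> d (Suc t)" using inj[of t "Suc t"] step[OF that] that(1) by auto
    moreover have "odd (d t)" "odd (d (Suc t))" using odd that(1) by auto
    moreover have "d (Suc t) \<le> d t + 2" "d t \<le> d (Suc t) + 2" using step[OF that] by simp_all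
    ultimately have "d (Suc t) = d t + 2 \<or> d t = d (Suc t) + 2" by presburger
    then show ?thesis using step[OF that] by simp
  qed
  \<comment> \<open>Turning around would lead back to the same depth of the same tooth, a place
    already visited.\<close>
  have no_back: "d t \<noteq> d (Suc (Suc t))" if "Suc (Suc t) < N" "d (Suc t) \<ge> 3" for t
    using step2[of t] step2[of "Suc t"] inj[of t "Suc (Suc t)"] that by auto
  \<comment> \<open>Once the walk goes deeper it can never turn, so it goes on descending until it
    ends.\<close>
  have up: "d t' \<ge> d t + 2" if "Suc t < N" "d (Suc t) = d t + 2" "t < t'" "t' < N" for t t'
  proof -
    have "Suc (t + i) < N \<longrightarrow> d (Suc (t + i)) = d (t + i) + 2 \<and> d (t + i) \<ge> d t" for i
    proof (induction i)
      case (Suc i)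
      show ?case
      proof
        assume N: "Suc (t + Suc i) < N"
        then have IH: "d (Suc (t + i)) = d (t + i) + 2" "d (t + i) \<ge> d t" using Suc by auto
        have "odd (d (t + i))" using odd N by auto
        then have "d (Suc (t + i)) \<ge> 3" using IH by (cases "d (t + i)") auto
        then show "d (Suc (t + Suc i)) = d (t + Suc i) + 2 \<and> d (t + Suc i) \<ge> d t"
          using step2[of "Suc (t + i)"] no_back[of "t + i"] IH N by auto
      qed
    qed (use that in auto)
    from this[of "t' - t - 1"] show ?thesis using that by auto
  qed
  \<comment> \<open>The time reversal of \<open>up\<close>: a walk that is ascending has been
    ascending from its start.\<close>
  have down: "d t' \<ge> d t + 2" if "Suc t < N" "d t = d (Suc t) + 2" "t' < t" for t t'
  proof -
    have "i \<le> t \<longrightarrow> d (t - i) = d (Suc (t - i)) + 2 \<and> d (t - i) \<ge> d t" for i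
    proof (induction i)
      case (Suc i)
      show ?case
      proof
        assume N: "Suc i \<le> t"
        define a where "a = t - Suc i"
        have a: "t - i = Suc a" "t - Suc i = a" "Suc (Suc a) < N" using N that(1) by (auto simp: a_def)
        have IH: "d (Suc a) = d (Suc (Suc a)) + 2" "d (Suc a) \<ge> d t" using Suc N a by auto
        have "odd (d (Suc (Suc a)))" using odd a by blast
        then have "d (Suc a) \<ge> 3" using IH by (cases "d (Suc (Suc a))") auto
        then have "d a = d (Suc a) + 2" using step2[of a] no_back[of a] IH a by force
        then show "d (t - Suc i) = d (Suc (t - Suc i)) + 2 \<and> d (t - Suc i) \<ge> d t"
          using IH a by simp
      qed
    qed (use that in auto)
    from this[of "t - t'"] this[of "t - Suc t'"] show ?thesis using that by auto
  qed
  define S where "S v = {t. t < N \<and> d t = v}" for v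
  have fin: "finite (S v)" for v by (simp add: S_def)
  have two: "card (S v) \<le> 2" if v: "v \<ge> 3" for v
  proof (rule ccontr)
    assume "\<not> card (S v) \<le> 2"
    then have "3 \<le> card (S v)" by simp
    then obtain T where T: "T \<subseteq> S v" "card T = 3" by (rule obtain_subset_with_card_n)
    then obtain a b c where abc: "T = {a, b, c}" "a \<noteq> b" "a \<noteq> c" "b \<noteq> c" using card_3_iff by metis
    \<comment> \<open>The step after the middle visit leads either deeper, and then the third visit
      is too deep, or back up, and then the first one was.\<close>
    have False if "i < j" "j < l" "i \<in> S v" "j \<in> S v" "l \<in> S v" for i j l
    proof -
      have ijl: "d i = v" "d j = v" "d l = v" "l < N" using that by (auto simp: S_def)
      have "d (Suc j) = v + 2 \<or> v = d (Suc j) + 2" using step2[of j] ijl that v by auto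
      then show False using up[of j l] down[of j i] ijl that by auto
    qed
    moreover have "a \<in> S v" "b \<in> S v" "c \<in> S v" using T abc by auto
    ultimately show False using abc by (metis linorder_neqE_nat)
  qed
  have one: "card (S 1) \<le> M"
  proof -
    have "inj_on Z (S 1)"
      by (rule linorder_inj_onI) (use inj in \<open>auto simp: S_def\<close>)
    then show ?thesis using base card_image unfolding S_def by metis
  qed
  have cover: "{..<N} \<subseteq> S 1 \<union> (\<Union>e\<in>{1..E}. S (2 * e + 1))"
  proof
    fix t assume t: "t \<in> {..<N}"
    then obtain e where e: "d t = 2 * e + 1" using odd oddE by blast
    then have "e \<le> E" using max[of t] t by simp
    then show "t \<in> S 1 \<union> (\<Union>e\<in>{1..E}. S (2 * e + 1))"
      using t e by (cases "e = 0") (auto simp: S_def)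
  qed
  have "N \<le> card (S 1 \<union> (\<Union>e\<in>{1..E}. S (2 * e + 1)))"
    using card_mono[OF _ cover] fin by simp
  also have "\<dots> \<le> card (S 1) + card (\<Union>e\<in>{1..E}. S (2 * e + 1))" by (rule card_Un_le)
  also have "\<dots> \<le> card (S 1) + (\<Sum>e\<in>{1..E}. card (S (2 * e + 1)))"
    using card_UN_le[of "{1..E}" "\<lambda>e. S (2 * e + 1)"] by simp
  finally have N: "N \<le> M + (\<Sum>e\<in>{1..E}. card (S (2 * e + 1)))" using one by simp
  moreover have "(\<Sum>e\<in>{1..E}. card (S (2 * e + 1))) \<le> (\<Sum>e\<in>{1..E}. 2)"
    by (rule sum_mono) (use two in auto)
  ultimately show "N \<le> M + 2 * E" by simp
  show "\<exists>t. N = Suc (Suc t) \<and> d t + 2 = 2 * E + 1 \<and> d (Suc t) = 2 * E + 1 \<and> Z t = Z (Suc t)"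
    if NE: "N = M + 2 * E" "E \<ge> 1"
  proof -
    have "(\<Sum>e\<in>{1..E}. card (S (2 * e + 1))) = card (S (2 * E + 1)) + (\<Sum>e\<in>{1..E} - {E}. card (S (2 * e + 1)))"
      using NE by (intro sum.remove) auto
    moreover have "(\<Sum>e\<in>{1..E} - {E}. card (S (2 * e + 1))) \<le> (\<Sum>e\<in>{1..E} - {E}. 2)"
      by (rule sum_mono) (use two in auto)
    moreover have "(\<Sum>e\<in>{1..E} - {E}. 2) = 2 * (E - 1)" using NE(2) by (simp add: card_Diff_singleton)
    ultimately have "card (S (2 * E + 1)) \<ge> 2" using N NE by linarith
    then obtain T where T: "T \<subseteq> S (2 * E + 1)" "card T = 2" by (rule obtain_subset_with_card_n)
    then obtain a b where ab: "a \<in> S (2 * E + 1)" "b \<in> S (2 * E + 1)" "a < b"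
      using card_2_iff by (metis insert_subset linorder_neqE_nat)
    then have dab: "d a = 2 * E + 1" "d b = 2 * E + 1" "b < N" by (auto simp: S_def)
    \<comment> \<open>A step after the second visit to the deepest level would lead up, and by
      \<open>down\<close> the first visit would have been deeper still.\<close>
    have "Suc b = N"
    proof (rule ccontr)
      assume "Suc b \<noteq> N"
      then have "Suc b < N" using dab by simp
      then have "d b = d (Suc b) + 2" using step2[of b] max[of "Suc b"] dab NE by auto
      then show False using down[of b a] dab ab \<open>Suc b < N\<close> up[of a b] step2[of a] max[of "Suc a"] NE
        by auto
    qed
    moreover obtain t where t: "b = Suc t" using ab by (cases b) auto
    ultimately show ?thesis using step2[of t] max[of t] dab NE by (intro exI[of _ t]) auto
  qed
qed

section \<open>Parities of the numbers of steps of either colour\<close>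

lemma even_half_step:
  fixes j :: nat
  shows "even j \<Longrightarrow> even ((Suc j + 1) div 2) \<longleftrightarrow> odd ((j + 1) div 2)"
    and "even j \<Longrightarrow> even (Suc j div 2) \<longleftrightarrow> even (j div 2)"
    and "odd j \<Longrightarrow> even ((Suc j + 1) div 2) \<longleftrightarrow> even ((j + 1) div 2)"
    and "odd j \<Longrightarrow> even (Suc j div 2) \<longleftrightarrow> odd (j div 2)"
  by presburger+

lemma even_iff_half_parities:
  fixes i j :: nat
  assumes "even ((i + 1) div 2) \<longleftrightarrow> even ((j + 1) div 2)" "even (i div 2) \<longleftrightarrow> even (j div 2)"
  shows "even i \<longleftrightarrow> even j"
  using assms by presburger

text \<open>For \<open>q = 0, 1, 2, 3\<close> the increments modulo two are \<open>(0,0)\<close>,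
  \<open>(1,0)\<close>, \<open>(1,1)\<close>, \<open>(0,1)\<close>, which are all parity
  pairs.\<close>

lemma ex_odd_halves:
  fixes a b :: nat
  shows "\<exists>q<4. odd (a + (q + 1) div 2) \<and> odd (b + q div 2)"
proof -
  consider "even a" "even b" | "even a" "odd b" | "odd a" "even b" | "odd a" "odd b" by blast
  then show ?thesis
  proof cases
    case 1
    then show ?thesis by (intro exI[of _ 2]) simp
  next
    case 2
    then show ?thesis by (intro exI[of _ 1]) simp
  next
    case 3
    then show ?thesis by (intro exI[of _ 3]) simp
  next
    case 4
    then show ?thesis by (intro exI[of _ 0]) simp
  qed
qed

subsection \<open>The arrangement\<close>

locale pinwheel =
  fixes k :: nat
  assumes odd_k: "odd k"
begin

definition n :: int where "n = 3 * int k"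

definition h :: real where "h = pi / of_int n"

text \<open>Outside the unit circle the blue line \<open>s\<close> stays close to the polar angles \<open>h * ray s\<close> and
  \<open>h * (ray s + n)\<close>.\<close>

definition ray :: "int \<Rightarrow> real" where
  "ray s = 3 * of_int (s div 2) + (1 + of_int (s mod 2)) / 3"

text \<open>A positive offset keeps the blue lines from meeting in the centre. On and outside the
  unit circle, \<open>sin (h / 6)\<close> limits the angular deviation of a blue line from its ray
  to \<open>1/6\<close>, half the distance \<open>1/3\<close> from the ray to the nearest integer
  angle or to the other ray of the cell.\<close>

definition eps :: real where "eps = sin (h / 6)"

text \<open>\<open>F i\<close> and \<open>G s\<close> are the affine functions vanishing on the red line \<open>i\<close> and on the blue line \<open>s\<close>.
  The index \<open>i\<close> matters modulo \<open>n\<close> only, whereas \<open>0 \<le> s < 2k\<close>.\<close>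

definition F :: "int \<Rightarrow> plane \<Rightarrow> real" where
  "F i P = dirv (2 * h * of_int i) \<bullet> P - 1"

definition G :: "int \<Rightarrow> plane \<Rightarrow> real" where
  "G s P = dirv (h * ray s + pi / 2) \<bullet> P - eps"

text \<open>Polar coordinates with the angle in units of \<open>h\<close>: a full turn is
  \<open>2 * n\<close>, the red lines touch the unit circle at even integers, and all integers are
  symmetry axes of the red lines.\<close>

definition pt :: "real \<Rightarrow> real \<Rightarrow> plane" where
  "pt r u = r *\<^sub>R dirv (h * u)"

lemma k_pos: "k > 0" using odd_k by (cases k) auto

lemma n_ge_3: "n \<ge> 3" using k_pos by (simp add: n_def)

lemma odd_n: "odd n" using odd_k by (simp add: n_def)

lemma h_pos: "h > 0" using n_ge_3 by (simp add: h_def)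

lemma h_n: "h * of_int n = pi" using n_ge_3 by (simp add: h_def)

lemma F_pt: "F i (pt r u) = r * cos (h * (u - 2 * of_int i)) - 1"
proof -
  have "2 * h * of_int i - h * u = - (h * (u - 2 * of_int i))" by (simp add: algebra_simps)
  then show ?thesis by (simp add: F_def pt_def inner_dirv del: minus_mult_right)
qed

lemma G_pt: "G s (pt r u) = r * sin (h * (u - ray s)) - eps"
proof -
  have "cos (h * ray s + pi / 2 - h * u) = sin (h * (u - ray s))"
    by (simp add: right_diff_distrib cos_diff cos_add sin_diff sin_add)
  then show ?thesis by (simp add: G_def pt_def inner_dirv)
qed

lemma exists_pt:
  obtains r u where "r \<ge> 0" "w < u" "u \<le> w + 2 * of_int n" "P = pt r u"
proof -
  obtain r t where t: "r \<ge> 0" "h * w < t" "t \<le> h * w + 2 * pi" "P = r *\<^sub>R dirv t"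
    using exists_polar by metis
  have "w < t / h" using t(2) h_pos by (simp add: field_simps)
  moreover have "t / h \<le> w + 2 * of_int n"
  proof -
    have "t \<le> h * (w + 2 * of_int n)" using t(3) h_n by (simp add: algebra_simps)
    then show ?thesis using h_pos by (simp add: field_simps)
  qed
  moreover have "P = pt r (t / h)" using t(4) h_pos by (simp add: pt_def)
  ultimately show thesis using that t(1) by blast
qed

section \<open>Signs of the sine in units of \<open>h\<close>\<close>

lemma sin_h_zero_iff: "sin (h * x) = 0 \<longleftrightarrow> (\<exists>m::int. x = of_int (n * m))"
proof -
  have "h * x = of_int m * pi \<longleftrightarrow> x = of_int (n * m)" for m
    using h_pos n_ge_3 by (auto simp: h_def field_simps)
  then show ?thesis by (simp add: sin_zero_iff_int2)
qed

lemma sin_h_int_zero_iff: "sin (h * of_int i) = 0 \<longleftrightarrow> n dvd i"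
  by (simp add: sin_h_zero_iff dvd_def del: of_int_mult)

lemma sin_h_pos: "0 < x \<Longrightarrow> x < of_int n \<Longrightarrow> sin (h * x) > 0"
  using h_pos h_n mult_strict_left_mono[of x "of_int n" h] by (intro sin_gt_zero) auto

lemma sin_h_nonneg: "0 \<le> x \<Longrightarrow> x \<le> of_int n \<Longrightarrow> sin (h * x) \<ge> 0"
  using h_pos h_n mult_left_mono[of x "of_int n" h] by (intro sin_ge_zero) auto

lemma sin_h_nonpos: "- of_int n \<le> x \<Longrightarrow> x \<le> 0 \<Longrightarrow> sin (h * x) \<le> 0"
  using sin_h_nonneg[of "- x"] by simp

lemma sin_h_shift: "sin (h * (x + of_int n)) = - sin (h * x)"
  using h_n by (simp add: distrib_left)

lemma sin_h_nonpos': "of_int n \<le> x \<Longrightarrow> x \<le> 2 * of_int n \<Longrightarrow> sin (h * x) \<le> 0"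
  using sin_h_nonneg[of "x - of_int n"] sin_h_shift[of "x - of_int n"] by simp

lemma pi_bounds_h: "h \<le> pi / 3"
  unfolding h_def using n_ge_3 by (intro divide_left_mono) auto

lemma eps_pos: "eps > 0"
  unfolding eps_def using h_pos pi_bounds_h by (intro sin_gt_zero) auto

lemma eps_less_sin_third: "eps < sin (h / 3)"
  unfolding eps_def using h_pos pi_bounds_h by (intro sin_monotone_2pi) auto

text \<open>Symmetry about \<open>n / 2\<close> reduces the claim to the increasing branch of the
  sine, where \<open>1/3\<close> exceeds the \<open>1/6\<close> in \<open>eps\<close>.\<close>

lemma sin_h_gt_eps:
  assumes "1/3 \<le> x" "x \<le> of_int n - 1/3"
  shows "sin (h * x) > eps"
proof -
  have A: "sin (h / 3) \<le> sin (h * y)" if "1/3 \<le> y" "y \<le> of_int n / 2" for y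
  proof (rule sin_monotone_2pi_le)
    show "h / 3 \<le> h * y" using that h_pos by (simp add: field_simps)
    show "h * y \<le> pi / 2" using mult_left_mono[OF that(2), of h] h_pos h_n by simp
    show "- (pi / 2) \<le> h / 3" using h_pos pi_gt_zero by linarith
  qed
  have "sin (h * (of_int n - x)) = sin (h * x)"
    using h_n by (simp add: right_diff_distrib)
  then show ?thesis
    using A[of x] A[of "of_int n - x"] eps_less_sin_third assms by (cases "x \<le> of_int n / 2") auto
qed

lemma G_pos:
  assumes "r > 1" "1/3 \<le> u - ray s" "u - ray s \<le> of_int n - 1/3"
  shows "G s (pt r u) > 0"
  using sin_h_gt_eps[OF assms(2,3)] assms(1) eps_pos mult_strict_mono[of 1 r eps "sin (h * (u - ray s))"]
  by (simp add: G_pt)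

text \<open>The offset favours the negative side, so no angular margin is required here, in contrast
  to \<open>G_pos\<close>.\<close>

lemma G_neg:
  assumes "r \<ge> 0" "sin (h * (u - ray s)) \<le> 0"
  shows "G s (pt r u) < 0"
  using mult_nonneg_nonpos[OF assms] eps_pos by (simp add: G_pt)

text \<open>The reflection in the axis at angle \<open>h * (i + j)\<close> exchanges the red lines
  \<open>i\<close> and \<open>j\<close>. The side of this axis decides which of the two functions is
  larger.\<close>

lemma F_diff:
  "F i (pt r u) - F j (pt r u) = 2 * r * sin (h * (u - of_int (i + j))) * sin (h * of_int (i - j))"
proof -
  have "cos (h * (u - 2 * of_int i)) - cos (h * (u - 2 * of_int j)) =
      2 * sin (h * (u - of_int (i + j))) * sin (h * of_int (i - j))"
    unfolding cos_diff_cos by (simp add: algebra_simps add_divide_distrib diff_divide_distrib)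
  then show ?thesis by (simp add: F_pt algebra_simps flip: right_diff_distrib)
qed

lemma F_mod: "F (i mod n) P = F i P"
proof -
  have m: "real_of_int (i mod n) = of_int i - of_int n * of_int (i div n)"
    by (simp add: minus_mult_div_eq_mod flip: of_int_mult of_int_diff)
  have "2 * h * of_int (i mod n) = 2 * h * of_int i - 2 * (h * of_int n) * of_int (i div n)"
    unfolding m by (simp add: algebra_simps)
  then have "2 * h * of_int (i mod n) = 2 * h * of_int i - 2 * pi * of_int (i div n)"
    unfolding h_n .
  then have "dirv (2 * h * of_int (i mod n)) = dirv (2 * h * of_int i)"
    by (simp add: dirv_def cos_diff sin_diff)
  then show ?thesis by (simp add: F_def)
qed

lemma F_pos_imp:
  assumes "F i (pt r u) \<ge> 0" "r \<ge> 0"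
  shows "r \<ge> 1"
proof (rule ccontr)
  assume "\<not> r \<ge> 1"
  then have "r * cos (h * (u - 2 * of_int i)) \<le> r * 1"
    using assms(2) by (intro mult_left_mono) auto
  then show False using assms(1) \<open>\<not> r \<ge> 1\<close> by (simp add: F_pt)
qed

lemma F_pos_imp_gt:
  assumes "F i (pt r u) > 0" "r \<ge> 0"
  shows "r > 1"
proof -
  have "r * cos (h * (u - 2 * of_int i)) \<le> r * 1"
    using assms(2) by (intro mult_left_mono) auto
  then show ?thesis using assms(1) by (simp add: F_pt)
qed

subsection \<open>Sectors cut out by the blue lines\<close>

definition Xs :: "plane \<Rightarrow> int set" where
  "Xs P = {i \<in> {0..<n}. F i P > 0}"

definition Ys :: "plane \<Rightarrow> int set" where
  "Ys P = {s \<in> {0..<2 * int k}. G s P > 0}"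

text \<open>\<open>W t\<close> is the set \<open>Ys\<close> in the \<open>t\<close>-th of the \<open>4k\<close> sectors into which the blue rays cut the exterior of
  the unit circle, counted counterclockwise from the polar angle 0.\<close>

definition W :: "int \<Rightarrow> int set" where
  "W t = (if t \<le> 2 * int k then {0..<t} else {t - 2 * int k..<2 * int k})"

lemma pt_shift: "pt r (u + 2 * of_int n) = pt r u"
proof -
  have "h * (u + 2 * of_int n) = h * u + 2 * pi" using h_n by (simp add: algebra_simps)
  then show ?thesis by (simp add: pt_def dirv_def)
qed

lemma ray_bounds: "3 * of_int (s div 2) + 1/3 \<le> ray s" "ray s \<le> 3 * of_int (s div 2) + 2/3"
proof -
  have "0 \<le> s mod 2" "s mod 2 \<le> 1" by auto
  then have "0 \<le> real_of_int (s mod 2)" "real_of_int (s mod 2) \<le> 1" by linarith+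
  then show "3 * of_int (s div 2) + 1/3 \<le> ray s" "ray s \<le> 3 * of_int (s div 2) + 2/3"
    by (simp_all add: ray_def)
qed

lemma ray_even: "ray (2 * r) = 3 * of_int r + 1/3" and ray_odd: "ray (2 * r + 1) = 3 * of_int r + 2/3"
  by (simp_all add: ray_def)

lemma div2_bounds:
  assumes "0 \<le> s" "s < 2 * int k"
  shows "0 \<le> real_of_int (s div 2)" "3 * real_of_int (s div 2) + 3 \<le> of_int n"
proof -
  have "s div 2 + 1 \<le> int k" using assms by presburger
  then have "0 \<le> s div 2" "3 * (s div 2) + 3 \<le> n" using assms by (auto simp: n_def)
  then show "0 \<le> real_of_int (s div 2)" "3 * real_of_int (s div 2) + 3 \<le> of_int n"
    by linarith+
qed

lemma G_pos_after:
  assumes "r > 1" "3 * of_int (s div 2) + 1 \<le> u" "u \<le> 3 * of_int (s div 2) + of_int n"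
  shows "G s (pt r u) > 0"
  using assms ray_bounds[of s] by (intro G_pos) auto

lemma G_neg_before:
  assumes "r \<ge> 0" "0 \<le> s" "s < 2 * int k" "0 \<le> u" "u \<le> 3 * of_int (s div 2)"
  shows "G s (pt r u) < 0"
  using assms ray_bounds[of s] div2_bounds[OF assms(2,3)] by (intro G_neg sin_h_nonpos) linarith+

lemma G_neg_after:
  assumes "r \<ge> 0" "0 \<le> s" "s < 2 * int k" "3 * of_int (s div 2) + of_int n + 1 \<le> u" "u \<le> 2 * of_int n"
  shows "G s (pt r u) < 0"
  using assms ray_bounds[of s] div2_bounds[OF assms(2,3)] by (intro G_neg sin_h_nonpos') linarith+

text \<open>In the first half-turn the lines enter the set in increasing order as their first rays
  are passed; in the second half-turn they leave it in the same order at the opposite rays.\<close>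

lemma Ys_between:
  assumes "r > 1" "1 \<le> q" "q \<le> 2 * int k" "3 * of_int q - 2 \<le> u" "u \<le> 3 * of_int q"
  shows "Ys (pt r u) = W (2 * q)"
proof (cases "q \<le> int k")
  case True
  have "G s (pt r u) > 0 \<longleftrightarrow> s < 2 * q" if s: "0 \<le> s" "s < 2 * int k" for s
  proof (cases "s < 2 * q")
    case less: True
    then have "s div 2 + 1 \<le> q" "q \<le> int k" using True by auto
    then have "real_of_int (s div 2) + 1 \<le> of_int q" "3 * real_of_int q \<le> of_int n" 
      unfolding n_def by linarith+
    then have "G s (pt r u) > 0"
      using assms div2_bounds[OF s] by (intro G_pos_after) linarith+
    then show ?thesis using less by simp
  next
    case False
    then have "real_of_int q \<le> of_int (s div 2)" by simp
    moreover have "1 \<le> real_of_int q" using assms(2) by simp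
    ultimately have "G s (pt r u) < 0" using assms s by (intro G_neg_before) linarith+
    then show ?thesis using False by simp
  qed
  then show ?thesis using True by (auto simp: Ys_def W_def)
next
  case False
  have n: "real_of_int n = 3 * real k" by (simp add: n_def)
  have "G s (pt r u) > 0 \<longleftrightarrow> s \<ge> 2 * q - 2 * int k" if s: "0 \<le> s" "s < 2 * int k" for s
  proof (cases "s \<ge> 2 * q - 2 * int k")
    case True
    then have "q - int k \<le> s div 2" by linarith
    then have "real_of_int q - real k \<le> of_int (s div 2)" by linarith
    moreover have "real k + 1 \<le> real_of_int q" using False by linarith
    ultimately have "G s (pt r u) > 0"
      using assms n div2_bounds[OF s] by (intro G_pos_after) linarith+
    then show ?thesis using True by simp
  next
    case less: False
    then have "s div 2 + 1 \<le> q - int k" by linarith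
    then have "real_of_int (s div 2) + 1 \<le> of_int q - real k" by linarith
    moreover have "real_of_int q \<le> 2 * real k" using assms(3) by linarith
    ultimately have "G s (pt r u) < 0" using assms s n by (intro G_neg_after) linarith+
    then show ?thesis using less by simp
  qed
  then show ?thesis using False by (auto simp: Ys_def W_def)
qed

text \<open>Only the two lines of the cell are undecided, and since their rays are passed in order,
  \<open>imp\<close> excludes one of the four sign patterns.\<close>

lemma Ys_eq_cases:
  assumes t: "0 \<le> t" "t + 2 \<le> 2 * int k"
    and pos: "\<And>s. 0 \<le> s \<Longrightarrow> s < t \<Longrightarrow> G s P > 0"
    and neg: "\<And>s. t + 2 \<le> s \<Longrightarrow> s < 2 * int k \<Longrightarrow> G s P < 0"
    and imp: "G (t + 1) P > 0 \<Longrightarrow> G t P > 0"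
  shows "Ys P = {0..<t} \<or> Ys P = {0..<t + 1} \<or> Ys P = {0..<t + 2}"
proof -
  have key: "G s P > 0 \<longleftrightarrow> s < t \<or> (s = t \<and> G t P > 0) \<or> (s = t + 1 \<and> G (t + 1) P > 0)"
    if "0 \<le> s" "s < 2 * int k" for s
  proof -
    consider "s < t" | "s = t" | "s = t + 1" | "s \<ge> t + 2" by linarith
    then show ?thesis by cases (use that pos[of s] neg[of s] in auto)
  qed
  then have mem: "s \<in> Ys P \<longleftrightarrow> 0 \<le> s \<and> s < 2 * int k \<and>
      (s < t \<or> (s = t \<and> G t P > 0) \<or> (s = t + 1 \<and> G (t + 1) P > 0))" for s
    unfolding Ys_def by simp blast
  consider "G (t + 1) P > 0" "G t P > 0" | "\<not> G (t + 1) P > 0" "G t P > 0"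
    | "\<not> G (t + 1) P > 0" "\<not> G t P > 0" using imp by blast
  then show ?thesis
  proof cases
    case 1
    then have "Ys P = {0..<t + 2}" unfolding set_eq_iff mem using t by auto
    then show ?thesis by simp
  next
    case 2
    then have "Ys P = {0..<t + 1}" unfolding set_eq_iff mem using t by auto
    then show ?thesis by simp
  next
    case 3
    then have "Ys P = {0..<t}" unfolding set_eq_iff mem using t by auto
    then show ?thesis by simp
  qed
qed

lemma Ys_eq_cases':
  assumes t: "0 \<le> t" "t + 2 \<le> 2 * int k"
    and neg: "\<And>s. 0 \<le> s \<Longrightarrow> s < t \<Longrightarrow> G s P < 0"
    and pos: "\<And>s. t + 2 \<le> s \<Longrightarrow> s < 2 * int k \<Longrightarrow> G s P > 0"
    and imp: "G t P > 0 \<Longrightarrow> G (t + 1) P > 0"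
  shows "Ys P = {t..<2 * int k} \<or> Ys P = {t + 1..<2 * int k} \<or> Ys P = {t + 2..<2 * int k}"
proof -
  have key: "G s P > 0 \<longleftrightarrow> s \<ge> t + 2 \<or> (s = t \<and> G t P > 0) \<or> (s = t + 1 \<and> G (t + 1) P > 0)"
    if "0 \<le> s" "s < 2 * int k" for s
  proof -
    consider "s < t" | "s = t" | "s = t + 1" | "s \<ge> t + 2" by linarith
    then show ?thesis by cases (use that pos[of s] neg[of s] in auto)
  qed
  then have mem: "s \<in> Ys P \<longleftrightarrow> 0 \<le> s \<and> s < 2 * int k \<and>
      (s \<ge> t + 2 \<or> (s = t \<and> G t P > 0) \<or> (s = t + 1 \<and> G (t + 1) P > 0))" for s
    unfolding Ys_def by simp blast
  consider "G (t + 1) P > 0" "G t P > 0" | "G (t + 1) P > 0" "\<not> G t P > 0"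
    | "\<not> G (t + 1) P > 0" "\<not> G t P > 0" using imp by blast
  then show ?thesis
  proof cases
    case 1
    then have "Ys P = {t..<2 * int k}" unfolding set_eq_iff mem using t by auto
    then show ?thesis by simp
  next
    case 2
    then have "Ys P = {t + 1..<2 * int k}" unfolding set_eq_iff mem using t by auto
    then show ?thesis by simp
  next
    case 3
    then have "Ys P = {t + 2..<2 * int k}" unfolding set_eq_iff mem using t by auto
    then show ?thesis by simp
  qed
qed

lemma Ys_in_cell:
  assumes "r > 1" "0 \<le> q" "q < 2 * int k" "3 * of_int q < u" "u < 3 * of_int q + 1"
  shows "Ys (pt r u) \<in> {W (2 * q), W (2 * q + 1), W (2 * q + 2)}"
proof (cases "q < int k")
  case True
  have pos: "G s (pt r u) > 0" if s: "0 \<le> s" "s < 2 * q" for s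
  proof -
    have "s div 2 + 1 \<le> q" "s < 2 * int k" "q + 1 \<le> int k" using s True by auto
    moreover from this have "real_of_int (s div 2) + 1 \<le> of_int q" "3 * real_of_int q + 3 \<le> of_int n" 
      unfolding n_def by linarith+
    ultimately show ?thesis using s assms div2_bounds[of s] by (intro G_pos_after) linarith+
  qed
  have neg: "G s (pt r u) < 0" if s: "2 * q + 2 \<le> s" "s < 2 * int k" for s
  proof -
    have "q + 1 \<le> s div 2" using s by linarith
    then have "real_of_int q + 1 \<le> of_int (s div 2)" by linarith
    moreover have "0 \<le> real_of_int q" using assms(2) by simp
    ultimately show ?thesis using s assms by (intro G_neg_before) linarith+
  qed
  \<comment> \<open>A positive sign puts \<open>u\<close> beyond the second ray, hence more than
    \<open>1/3\<close> beyond the first one, which is the margin \<open>G_pos\<close> asks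
    for.\<close>
  have imp: "G (2 * q) (pt r u) > 0" if G:  "G (2 * q + 1) (pt r u) > 0"
  proof -
    have "3 * real_of_int q + 3 \<le> of_int n" using True by (simp add: n_def flip: of_int_add)
    have "\<not> sin (h * (u - ray (2 * q + 1))) \<le> 0"
      using G G_neg[of r u "2 * q + 1"] assms(1) by auto
    then have "u > ray (2 * q + 1)"
      using sin_h_nonpos[of "u - ray (2 * q + 1)"] assms(2,4) \<open>3 * real_of_int q + 3 \<le> of_int n\<close>
      unfolding ray_odd by linarith
    then have "1/3 \<le> u - ray (2 * q)" "u - ray (2 * q) \<le> of_int n - 1/3"
      using assms(2,5) \<open>3 * real_of_int q + 3 \<le> of_int n\<close> unfolding ray_even ray_odd by linarith+
    then show ?thesis using assms(1) G_pos by blast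
  qed
  have "Ys (pt r u) = {0..<2 * q} \<or> Ys (pt r u) = {0..<2 * q + 1} \<or> Ys (pt r u) = {0..<2 * q + 2}"
    using Ys_eq_cases[OF _ _ pos neg imp] True assms(2) by simp
  then show ?thesis using True by (auto simp: W_def)
next
  case False
  define p where "p = q - int k"
  have n: "real_of_int n = 3 * real k" by (simp add: n_def)
  have p: "real_of_int p = of_int q - real k" "0 \<le> p" "p < int k" using False assms by (auto simp: p_def)
  then have p': "0 \<le> real_of_int p" "real_of_int p + 1 \<le> real k" by linarith+
  have neg: "G s (pt r u) < 0" if s: "0 \<le> s" "s < 2 * p" for s
  proof -
    have "s div 2 + 1 \<le> p" using s by linarith
    then have "real_of_int (s div 2) + 1 \<le> of_int p" by linarith
    then show ?thesis using s assms p p' n by (intro G_neg_after) linarith+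
  qed
  have pos: "G s (pt r u) > 0" if s: "2 * p + 2 \<le> s" "s < 2 * int k" for s
  proof -
    have "p + 1 \<le> s div 2" using s by linarith
    then have "real_of_int p + 1 \<le> of_int (s div 2)" by linarith
    then show ?thesis using s assms p p' div2_bounds[of s] n by (intro G_pos_after) linarith+
  qed
  have imp: "G (2 * p + 1) (pt r u) > 0" if G: "G (2 * p) (pt r u) > 0"
  proof -
    have "\<not> sin (h * (u - ray (2 * p))) \<le> 0"
      using G G_neg[of r u "2 * p"] assms(1) by auto
    then have "u < ray (2 * p) + of_int n"
      using sin_h_nonpos'[of "u - ray (2 * p)"] assms(5) p p' n unfolding ray_even by linarith
    then have "1/3 \<le> u - ray (2 * p + 1)" "u - ray (2 * p + 1) \<le> of_int n - 1/3"
      using assms(4) p p' n unfolding ray_even ray_odd by linarith+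
    then show ?thesis using assms(1) G_pos by blast
  qed
  have "Ys (pt r u) = {2 * p..<2 * int k} \<or> Ys (pt r u) = {2 * p + 1..<2 * int k} \<or>
      Ys (pt r u) = {2 * p + 2..<2 * int k}"
    using Ys_eq_cases'[OF _ _ neg pos imp] p by simp
  moreover have "W (2 * q) = {2 * p..<2 * int k}" "W (2 * q + 1) = {2 * p + 1..<2 * int k}"
    "W (2 * q + 2) = {2 * p + 2..<2 * int k}"
    using False by (auto simp: W_def p_def)
  ultimately show ?thesis by simp
qed

lemma card_W:
  assumes "0 \<le> t" "t \<le> 4 * int k"
  shows "int (card (W t)) = (if t \<le> 2 * int k then t else 4 * int k - t)"
  using assms by (simp add: W_def)

lemma even_card_W: "0 \<le> t \<Longrightarrow> t \<le> 4 * int k \<Longrightarrow> even (card (W t)) \<longleftrightarrow> even t"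
proof -
  assume "0 \<le> t" "t \<le> 4 * int k"
  then have "even (int (card (W t))) \<longleftrightarrow> even t" by (subst card_W) auto
  then show ?thesis by simp
qed

lemma cell_or_between:
  fixes u :: real
  assumes "0 < u" "u \<le> 2 * of_int n"
  obtains (cell) q where "0 \<le> q" "q < 2 * int k" "3 * of_int q < u" "u < 3 * of_int q + 1"
  | (between) q where "1 \<le> q" "q \<le> 2 * int k" "3 * of_int q - 2 \<le> u" "u \<le> 3 * of_int q"
proof -
  define q where "q = \<lceil>u / 3\<rceil> - 1"
  have "of_int q < u / 3" "u / 3 \<le> of_int q + 1"
    using ceiling_correct[of "u / 3"] by (simp_all add: q_def)
  then have q: "3 * of_int q < u" "u \<le> 3 * of_int q + 3" by simp_all
  have n: "real_of_int n = 3 * real k" by (simp add: n_def)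
  have "real_of_int q < 2 * real k" "real_of_int q > -1" using q assms n by linarith+
  then have "0 \<le> q" "q < 2 * int k" by linarith+
  then show thesis using q that(1)[of q] that(2)[of "q + 1"] by (cases "u < 3 * of_int q + 1") auto
qed

text \<open>\<open>|W t|\<close> has the parity of \<open>t\<close>. Gaps have even sector index,
  and of the three sectors meeting a cell only the middle one has an odd index.\<close>

lemma odd_Ys_cell:
  assumes "r > 1" "0 < u" "u \<le> 2 * of_int n" "odd (card (Ys (pt r u)))"
  obtains q where "0 \<le> q" "q < 2 * int k" "3 * of_int q < u" "u < 3 * of_int q + 1"
    "Ys (pt r u) = W (2 * q + 1)"
  using assms(2,3)
proof (cases rule: cell_or_between)
  case (cell q)
  then show ?thesis
    using Ys_in_cell[OF assms(1) cell] that[of q] assms(4) even_card_W[of "2 * q"] even_card_W[of "2 * q + 2"]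
    by auto
next
  case (between q)
  then show ?thesis using Ys_between[OF assms(1) between] assms(4) even_card_W[of "2 * q"] by auto
qed

text \<open>The window for \<open>u'\<close> covers the gap before cell \<open>q\<close> together
  with both adjoining cells. The angle is renormalised so that this window never wraps
  around.\<close>

lemma even_Ys_sector:
  assumes "r > 1" "0 < u" "u \<le> 2 * of_int n" "even (card (Ys (pt r u)))"
  obtains q u' where "1 \<le> q" "q \<le> 2 * int k" "3 * of_int q - 3 < u'" "u' < 3 * of_int q + 1"
    "Ys (pt r u) = W (2 * q)" "pt r u = pt r u'"
  using assms(2,3)
proof (cases rule: cell_or_between)
  case (cell q)
  have "Ys (pt r u) \<noteq> W (2 * q + 1)"
    using assms(4) even_card_W[of "2 * q + 1"] cell by auto
  then consider "Ys (pt r u) = W (2 * q + 2)" | "Ys (pt r u) = W (2 * q)"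
    using Ys_in_cell[OF assms(1) cell] by auto
  then show ?thesis
  proof cases
    case 1
    then show ?thesis using that[of "q + 1" u] cell by (simp add: distrib_left)
  next
    case 2
    show ?thesis
    proof (cases "q = 0")
      case True
      have n: "real_of_int n = 3 * real k" by (simp add: n_def)
      \<comment> \<open>The sector before the first cell is the one after the last cell, so a full
        turn is added.\<close>
      have "W (2 * q) = W (2 * (2 * int k))" using True k_pos by (simp add: W_def)
      show ?thesis
      proof (rule that)
        show "Ys (pt r u) = W (2 * (2 * int k))"
          using 2 \<open>W (2 * q) = W (2 * (2 * int k))\<close> by (rule trans)
        show "pt r u = pt r (u + 2 * of_int n)" by (simp only: pt_shift)
      qed (use cell True k_pos n in auto)
    next
      case False
      then show ?thesis using that[of q u] cell 2 by simp
    qed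
  qed
next
  case (between q)
  then show ?thesis using that[of q u] Ys_between[OF assms(1) between] by simp
qed

text \<open>The sets of the first half-turn are initial segments and those of the second are final
  segments. One of either kind can be nested only at the empty or the full set, so a change of one
  element means neighbouring sectors in the cyclic order.\<close>

lemma W_adjacent:
  assumes r: "0 \<le> r" "r < 2 * int k" and q: "1 \<le> q" "q \<le> 2 * int k"
    and adj: "(j \<notin> W (2 * q) \<and> W (2 * r + 1) = insert j (W (2 * q))) \<or>
      (j \<notin> W (2 * r + 1) \<and> W (2 * q) = insert j (W (2 * r + 1)))"
  shows "q = r \<or> q = r + 1 \<or> (r = 0 \<and> q = 2 * int k)"
proof -
  have fin: "finite (W t)" for t by (simp add: W_def)
  have card: "int (card (W (2 * q))) = int (card (W (2 * r + 1))) + 1 \<or>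
      int (card (W (2 * r + 1))) = int (card (W (2 * q))) + 1"
    using adj fin by auto
  have sub: "W (2 * r + 1) \<subseteq> W (2 * q) \<or> W (2 * q) \<subseteq> W (2 * r + 1)" using adj by auto
  have cards: "int (card (W (2 * q))) = (if 2 * q \<le> 2 * int k then 2 * q else 4 * int k - 2 * q)"
    "int (card (W (2 * r + 1))) = (if 2 * r + 1 \<le> 2 * int k then 2 * r + 1 else 4 * int k - (2 * r + 1))"
    using r q by (intro card_W; simp)+
  consider "2 * q \<le> 2 * int k \<longleftrightarrow> 2 * r + 1 \<le> 2 * int k"
    | "2 * q > 2 * int k" "2 * r + 1 \<le> 2 * int k" | "2 * q \<le> 2 * int k" "2 * r + 1 > 2 * int k"
    by linarith
  then show ?thesis
  proof cases
    case 1
    then show ?thesis using card cards by (auto split: if_splits)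
  next
    case 2
    then have "0 \<in> W (2 * r + 1)" "0 \<notin> W (2 * q)" using r by (auto simp: W_def)
    then have sub': "W (2 * q) \<subseteq> W (2 * r + 1)" using sub by blast
    have "2 * q = 4 * int k"
    proof (rule ccontr)
      assume "2 * q \<noteq> 4 * int k"
      then have "2 * int k - 1 \<in> W (2 * q)" using 2 q by (auto simp: W_def)
      then have "2 * int k - 1 \<in> W (2 * r + 1)" using sub' by blast
      then have "2 * int k - 1 < 2 * r + 1" using 2 by (simp add: W_def)
      then show False using 2 by presburger
    qed
    then show ?thesis using card cards 2 by auto
  next
    case 3
    then have "0 \<in> W (2 * q)" "0 \<notin> W (2 * r + 1)" using q by (auto simp: W_def)
    then have sub': "W (2 * r + 1) \<subseteq> W (2 * q)" using sub by blast
    have "2 * int k - 1 \<in> W (2 * r + 1)" using 3 r by (auto simp: W_def)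
    then have "2 * int k - 1 \<in> W (2 * q)" using sub' by blast
    then have "q = int k" using 3 by (auto simp: W_def)
    then show ?thesis using card cards 3 by auto
  qed
qed

subsection \<open>Sets of visible red lines\<close>

text \<open>The set of red lines separating \<open>P\<close> from the centre is closed under both reflections
  \<open>i \<mapsto> m - i\<close> and \<open>i \<mapsto> m + 1 - i\<close>, hence under translation by one.\<close>

lemma visible_all_if_reflections:
  fixes m :: int
  assumes r: "r \<ge> 0" "r' \<ge> 0" and P: "P = pt r u" and R: "R = pt r' u'"
    and sides: "\<And>s. s \<in> {m, m + 1} \<Longrightarrow>
      (sin (h * (u - of_int s)) \<le> 0 \<and> sin (h * (u' - of_int s)) \<ge> 0) \<or>
      (sin (h * (u - of_int s)) \<ge> 0 \<and> sin (h * (u' - of_int s)) \<le> 0)"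
    and sub: "\<And>i. F i R > 0 \<Longrightarrow> F i P > 0" "\<And>i. F i P > 0 \<Longrightarrow> F i R \<ge> 0"
    and uniq: "\<And>i j. F i R = 0 \<Longrightarrow> F j R = 0 \<Longrightarrow> i mod n = j mod n"
    and i: "F i P > 0"
  shows "F j P > 0"
proof -
  have refl: "F (s - i) P > 0" if s: "s \<in> {m, m + 1}" and i: "F i P > 0" for s i
  proof -
    define A where "A = sin (h * of_int (i - (s - i)))"
    have dP: "F i P - F (s - i) P = 2 * r * (sin (h * (u - of_int s)) * A)"
      and dR: "F i R - F (s - i) R = 2 * r' * (sin (h * (u' - of_int s)) * A)"
      unfolding P R F_diff A_def by simp_all
    \<comment> \<open>\<open>P\<close> and \<open>R\<close> lie on opposite sides of the axis
      \<open>s\<close>, so for at least one of them line \<open>s - i\<close> has a value no smaller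
      than line \<open>i\<close>.\<close>
    have "sin (h * (u - of_int s)) * A \<le> 0 \<or> sin (h * (u' - of_int s)) * A \<le> 0"
      using sides[OF s] by (cases "A \<ge> 0") (auto simp: mult_le_0_iff)
    then have "2 * r * (sin (h * (u - of_int s)) * A) \<le> 0 \<or> 2 * r' * (sin (h * (u' - of_int s)) * A) \<le> 0"
      using r by (metis mult_nonneg_nonpos mult_nonneg_nonneg zero_le_numeral)
    then have "F i P \<le> F (s - i) P \<or> F i R \<le> F (s - i) R"
      unfolding dP[symmetric] dR[symmetric] by simp
    then show ?thesis
    proof
      assume "F i P \<le> F (s - i) P"
      then show ?thesis using i by simp
    next
      assume le: "F i R \<le> F (s - i) R"
      show ?thesis
      proof (cases "F (s - i) R > 0")
        case True
        then show ?thesis using sub by blast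
      next
        case False
        \<comment> \<open>In the remaining case both lines pass through \<open>R\<close>, and
          \<open>uniq\<close> identifies them modulo \<open>n\<close>.\<close>
        then have "F i R = 0" "F (s - i) R = 0" using le sub(2)[OF i] by auto
        then have "i mod n = (s - i) mod n" using uniq by blast
        then show ?thesis using i F_mod by metis
      qed
    qed
  qed
  have step: "F (i + 1) P > 0" if "F i P > 0" for i
    using refl[of "m + 1" "m - i"] refl[of m i] that by (simp add: add.commute)
  have "F (i + int t) P > 0" for t
  proof (induction t)
    case (Suc t)
    then show ?case using step[of "i + int t"] by (simp add: algebra_simps)
  qed (use i in simp)
  moreover have "(i + int (nat ((j - i) mod n))) mod n = j mod n"
    using n_ge_3 by (simp add: mod_simps)
  ultimately show ?thesis using F_mod by metis
qed

text \<open>In this scale the sine vanishes only at integers, so it keeps its sign on an open unit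
  interval.\<close>

lemma sin_h_same_sign:
  fixes c :: int
  assumes "of_int c < x" "x < of_int c + 1" "of_int c < y" "y < of_int c + 1"
  shows "sin (h * x) * sin (h * y) > 0"
proof -
  have nz: "sin (h * z) \<noteq> 0" if "of_int c < z" "z < of_int c + 1" for z
  proof
    assume "sin (h * z) = 0"
    then obtain m where "z = of_int (n * m)" using sin_h_zero_iff by blast
    then have "c < n * m" "n * m < c + 1" using that by linarith+
    then show False by simp
  qed
  have conn: "connected ((\<lambda>z. sin (h * z)) ` {of_int c <..< of_int c + 1})"
    by (intro connected_continuous_image continuous_intros) auto
  have False if "sin (h * a) < 0" "sin (h * b) > 0" "a \<in> {of_int c <..< of_int c + 1}"
    "b \<in> {of_int c <..< of_int c + 1}" for a b
  proof -
    have "{sin (h * a)..sin (h * b)} \<subseteq> (\<lambda>z. sin (h * z)) ` {of_int c <..< of_int c + 1}"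
      using that by (intro connected_contains_Icc[OF conn]) auto
    then have "0 \<in> (\<lambda>z. sin (h * z)) ` {of_int c <..< of_int c + 1}" using that by force
    then show False using nz by auto
  qed
  then show ?thesis using nz[of x] nz[of y] assms
    by (smt (verit) greaterThanLessThan_iff mult_neg_neg mult_pos_pos)
qed

text \<open>Within a cell the red lines are ordered by their angular distance, so the visible sets form a chain.\<close>

lemma visible_chain:
  fixes c :: int
  assumes r: "r \<ge> 0" "r' \<ge> 0" and u: "of_int c < u" "u < of_int c + 1" "of_int c < u'" "u' < of_int c + 1"
  shows "(\<forall>i. F i (pt r u) > 0 \<longrightarrow> F i (pt r' u') > 0) \<or> (\<forall>i. F i (pt r' u') > 0 \<longrightarrow> F i (pt r u) > 0)"
proof (rule ccontr)
  assume "\<not> ?thesis"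
  then obtain i j where i: "F i (pt r u) > 0" "\<not> F i (pt r' u') > 0"
    and j: "F j (pt r' u') > 0" "\<not> F j (pt r u) > 0" by blast
  define A where "A = sin (h * of_int (i - j))"
  define s where "s = i + j"
  have "0 < F i (pt r u) - F j (pt r u)" using i j by simp
  then have 1: "0 < 2 * r * (sin (h * (u - of_int s)) * A)"
    unfolding F_diff A_def s_def by (simp add: mult.assoc)
  have "F i (pt r' u') - F j (pt r' u') < 0" using i j by simp
  then have 2: "2 * r' * (sin (h * (u' - of_int s)) * A) < 0"
    unfolding F_diff A_def s_def by (simp add: mult.assoc)
  have "0 < sin (h * (u - of_int s)) * A" "sin (h * (u' - of_int s)) * A < 0"
    using 1 2 r by (auto simp: zero_less_mult_iff mult_less_0_iff)
  then have "(sin (h * (u - of_int s)) * A) * (sin (h * (u' - of_int s)) * A) < 0"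
    by (rule mult_pos_neg)
  then have "(sin (h * (u - of_int s)) * sin (h * (u' - of_int s))) * (A * A) < 0"
    by (simp add: algebra_simps)
  \<comment> \<open>The axis \<open>i + j\<close> would have to separate the two points, but no
    integer angle lies inside the cell.\<close>
  moreover have "sin (h * (u - of_int s)) * sin (h * (u' - of_int s)) > 0"
    using u by (intro sin_h_same_sign[of "c - s"]) auto
  ultimately show False
    by (metis mult_nonneg_nonneg less_imp_le not_less zero_le_square)
qed

section \<open>Counting visible red lines\<close>

lemma finite_Xs: "finite (Xs P)" by (rule finite_subset[of _ "{0..<n}"]) (auto simp: Xs_def)

lemma finite_Ys: "finite (Ys P)" by (rule finite_subset[of _ "{0..<2 * int k}"]) (auto simp: Ys_def)

lemma F_pos_iff_Xs: "F i P > 0 \<longleftrightarrow> i mod n \<in> Xs P"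
  using n_ge_3 by (simp add: Xs_def F_mod)

lemma Xs_eq_in_cell:
  fixes c :: int
  assumes "r \<ge> 0" "r' \<ge> 0" "of_int c < u" "u < of_int c + 1" "of_int c < u'" "u' < of_int c + 1"
    and "card (Xs (pt r u)) = card (Xs (pt r' u'))"
  shows "Xs (pt r u) = Xs (pt r' u')"
proof -
  have "Xs (pt r u) \<subseteq> Xs (pt r' u') \<or> Xs (pt r' u') \<subseteq> Xs (pt r u)"
    using visible_chain[OF assms(1-6)] by (auto simp: Xs_def)
  then show ?thesis using assms(7) finite_Xs by (metis card_subset_eq)
qed

text \<open>A visible line has its contact point less than a quarter turn away, so its index lies in
  an open interval of length \<open>n / 2\<close> around \<open>u / 2\<close>.\<close>

lemma card_Xs_le: "2 * int (card (Xs P)) \<le> n + 1"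
proof -
  obtain r u where P: "r \<ge> 0" "P = pt r u" using exists_pt by metis
  have n3: "real_of_int n \<ge> 3" using n_ge_3 by simp
  \<comment> \<open>\<open>g i\<close> is the representative of \<open>i\<close> modulo
    \<open>n\<close> nearest to \<open>u / 2\<close>.\<close>
  define g where "g i = i + n * round ((u / 2 - of_int i) / of_int n)" for i
  define lo hi where "lo = \<lfloor>u / 2 - of_int n / 4\<rfloor> + 1" and "hi = \<lceil>u / 2 + of_int n / 4\<rceil>"
  have "g ` Xs P \<subseteq> {lo..<hi}"
  proof
    fix j assume "j \<in> g ` Xs P"
    then obtain i where i: "i \<in> Xs P" "j = g i" by blast
    have jm: "j mod n = i mod n" by (simp add: i g_def)
    then have "F j P > 0" using i(1) F_mod by (metis (no_types, lifting) Xs_def mem_Collect_eq)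
    then have "r * cos (h * (u - 2 * of_int j)) > 0" by (simp add: P F_pt)
    then have cos: "cos (h * (u - 2 * of_int j)) > 0" using P(1) by (simp add: zero_less_mult_iff)
    define x where "x = (u / 2 - of_int i) / of_int n"
    have "\<bar>x - of_int (round x)\<bar> \<le> 1/2" using of_int_round_abs_le[of x] by (simp add: abs_minus_commute)
    then have "\<bar>x - of_int (round x)\<bar> * of_int n \<le> 1/2 * of_int n" using n3 by (intro mult_right_mono) auto
    moreover have "(x - of_int (round x)) * of_int n = u / 2 - of_int j"
      unfolding i(2) g_def x_def using n3 by (simp add: field_simps)
    then have "\<bar>u / 2 - of_int j\<bar> = \<bar>x - of_int (round x)\<bar> * of_int n"
      using n3 by (metis abs_mult abs_of_pos less_le_trans zero_less_numeral)
    ultimately have "\<bar>u - 2 * of_int j\<bar> \<le> of_int n" by simp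
    then have "h * \<bar>u - 2 * of_int j\<bar> \<le> pi"
      using mult_left_mono[of _ "of_int n" h] h_pos h_n by fastforce
    moreover have "cos (h * \<bar>u - 2 * of_int j\<bar>) > 0"
      using cos h_pos cos_abs_real[of "h * (u - 2 * of_int j)"] by (simp add: abs_mult)
    ultimately have "h * \<bar>u - 2 * of_int j\<bar> < pi / 2"
      using cos_monotone_0_pi_le[of "pi / 2" "h * \<bar>u - 2 * of_int j\<bar>"] h_pos by force
    then have "\<bar>u - 2 * of_int j\<bar> < of_int n / 2" using h_pos n3 by (simp add: h_def field_simps)
    then have "u / 2 - of_int n / 4 < of_int j" "of_int j < u / 2 + of_int n / 4" by (auto simp: abs_if split: if_splits)
    then have "\<lfloor>u / 2 - of_int n / 4\<rfloor> < j" "j < hi"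
      unfolding hi_def by (simp_all only: floor_less_iff less_ceiling_iff)
    then show "j \<in> {lo..<hi}" unfolding lo_def by simp
  qed
  moreover have "inj_on g (Xs P)"
  proof
    fix i j assume "i \<in> Xs P" "j \<in> Xs P" "g i = g j"
    then have "i mod n = j mod n" unfolding g_def by (metis mod_mult_self2)
    then show "i = j" using \<open>i \<in> Xs P\<close> \<open>j \<in> Xs P\<close> by (simp add: Xs_def)
  qed
  ultimately have "card (Xs P) \<le> nat (hi - lo)"
    by (metis card_atLeastLessThan_int card_inj_on_le finite_atLeastLessThan_int)
  moreover have "2 * (hi - lo) \<le> n + 1"
  proof -
    have "real_of_int (hi - lo) < of_int n / 2 + 1"
      unfolding lo_def hi_def using ceiling_correct[of "u / 2 + of_int n / 4"] floor_correct[of "u / 2 - of_int n / 4"]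
      by linarith
    then have "real_of_int (2 * (hi - lo)) < of_int (n + 2)" by simp
    then have "2 * (hi - lo) < n + 2" by (simp only: of_int_less_iff)
    then show ?thesis using odd_n by presburger
  qed
  ultimately show ?thesis using n_ge_3 by (cases "0 \<le> hi - lo") simp_all
qed

subsection \<open>Simplicity\<close>

definition angle :: "int + int \<Rightarrow> real" where
  "angle = case_sum (\<lambda>i. 2 * h * of_int i) (\<lambda>s. h * ray s + pi / 2)"

definition normal :: "int + int \<Rightarrow> plane" where
  "normal x = dirv (angle x)"

definition offset :: "int + int \<Rightarrow> real" where
  "offset = case_sum (\<lambda>i. 1) (\<lambda>s. eps)"

definition idx :: "(int + int) set" where
  "idx = Inl ` {0..<n} \<union> Inr ` {0..<2 * int k}"

definition line :: "int + int \<Rightarrow> plane set" where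
  "line x = hyperplane (normal x) (offset x)"

lemma F_eq: "F i P = normal (Inl i) \<bullet> P - offset (Inl i)"
  and G_eq: "G s P = normal (Inr s) \<bullet> P - offset (Inr s)"
  by (simp_all add: F_def G_def normal_def angle_def offset_def)

lemma mem_line: "P \<in> line (Inl i) \<longleftrightarrow> F i P = 0" "P \<in> line (Inr s) \<longleftrightarrow> G s P = 0"
  by (simp_all add: line_def hyperplane_def F_eq G_eq)

lemma ray_less:
  assumes "0 \<le> s" "s < t" "t < 2 * int k"
  shows "ray s < ray t" "ray t - ray s \<le> of_int n - 1"
proof -
  show "ray s < ray t"
  proof (cases "s div 2 = t div 2")
    case True
    then have "s mod 2 = 0" "t mod 2 = 1" using assms(2) by presburger+
    then show ?thesis using True by (simp add: ray_def)
  next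
    case False
    then have "s div 2 + 1 \<le> t div 2" using assms(2) by presburger
    then have "real_of_int (s div 2) + 1 \<le> of_int (t div 2)" by linarith
    then show ?thesis using ray_bounds[of s] ray_bounds[of t] by linarith
  qed
  show "ray t - ray s \<le> of_int n - 1"
    using ray_bounds[of s] ray_bounds[of t] div2_bounds[of s] div2_bounds[of t] assms by linarith
qed

lemma abs_sin_h_shift: "\<bar>sin (h * (x + of_int (n * m)))\<bar> = \<bar>sin (h * x)\<bar>"
proof -
  have "h * (x + of_int (n * m)) = h * x + (h * of_int n) * of_int m" by (simp add: algebra_simps)
  then have "h * (x + of_int (n * m)) = h * x + pi * of_int m" unfolding h_n .
  moreover have "sin (pi * of_int m) = 0" by simp
  moreover from this have "\<bar>cos (pi * of_int m)\<bar> = 1"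
    using sin_cos_squared_add[of "pi * of_int m"] by (simp add: abs_square_eq_1)
  ultimately show ?thesis by (simp add: sin_add abs_mult)
qed

lemma eps_less_sin_int_ray: "eps < \<bar>sin (h * (of_int c - ray s))\<bar>"
proof -
  \<comment> \<open>The shift by one makes \<open>z\<close> the sum of a remainder in
    \<open>[0, n - 1]\<close> and a term in \<open>[1/3, 2/3]\<close>, so that \<open>z\<close>
    keeps distance \<open>1/3\<close> from both \<open>0\<close> and \<open>n\<close>.\<close>
  define d where "d = c - 3 * (s div 2) - 1"
  define z where "z = of_int (d mod n) + (3 * of_int (s div 2) + 1 - ray s)"
  have "of_int d = real_of_int (n * (d div n)) + of_int (d mod n)"
    by (simp flip: of_int_mult of_int_add)
  then have "of_int c - ray s = z + of_int (n * (d div n))"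
    by (simp add: z_def d_def)
  then have "\<bar>sin (h * (of_int c - ray s))\<bar> = \<bar>sin (h * z)\<bar>" using abs_sin_h_shift by metis
  moreover have "0 \<le> d mod n" "d mod n + 1 \<le> n" using n_ge_3 pos_mod_bound[of n d] by (simp, linarith)
  then have "0 \<le> real_of_int (d mod n)" "real_of_int (d mod n) + 1 \<le> of_int n" by linarith+
  then have "1/3 \<le> z" "z \<le> of_int n - 1/3" using ray_bounds[of s] unfolding z_def by linarith+
  then have "sin (h * z) > eps" by (rule sin_h_gt_eps)
  ultimately show ?thesis by linarith
qed

lemma abs_sin_le_eps:
  assumes "r \<ge> 1" "G s (pt r u) = 0"
  shows "\<bar>sin (h * (u - ray s))\<bar> \<le> eps"
proof -
  have "r * \<bar>sin (h * (u - ray s))\<bar> = eps"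
    using assms eps_pos by (metis G_pt abs_mult abs_of_nonneg abs_of_pos eq_iff_diff_eq_0 order_trans zero_le_one)
  then show ?thesis using assms(1) mult_right_mono[of 1 r "\<bar>sin (h * (u - ray s))\<bar>"] by simp
qed

text \<open>Two tangents of the unit circle meet on the axis that exchanges them; hence red
  crossings have integer angles.\<close>

lemma two_red:
  assumes "F i (pt r u) = 0" "F j (pt r u) = 0" "r \<ge> 0" "i \<in> {0..<n}" "j \<in> {0..<n}" "i \<noteq> j"
  shows "sin (h * (u - of_int (i + j))) = 0"
proof -
  have "\<not> n dvd i - j" using assms(4-6) by (simp flip: mod_eq_dvd_iff)
  then have "sin (h * of_int (i - j)) \<noteq> 0" using sin_h_int_zero_iff by blast
  moreover have "r \<noteq> 0" using assms(1,3) F_pos_imp[of i r u] by auto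
  ultimately show ?thesis using F_diff[of i r u j] assms(1,2) by auto
qed

text \<open>Two tangents of the small circle meet on the bisector of their normals, a quarter turn
  from the mean of their rays.\<close>

lemma two_blue:
  assumes "G s (pt r u) = 0" "G t (pt r u) = 0" "s \<in> {0..<2 * int k}" "t \<in> {0..<2 * int k}" "s \<noteq> t"
  shows "cos (h * (u - (ray s + ray t) / 2)) = 0"
proof -
  have "r \<noteq> 0" using assms(1) eps_pos by (auto simp: G_pt)
  moreover have "r * sin (h * (u - ray s)) = r * sin (h * (u - ray t))"
    using assms(1,2) unfolding G_pt by linarith
  ultimately have "sin (h * (u - ray s)) = sin (h * (u - ray t))" by simp
  then have "2 * sin ((h * (u - ray s) - h * (u - ray t)) / 2) * cos ((h * (u - ray s) + h * (u - ray t)) / 2) = 0"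
    by (subst sin_diff_sin[symmetric]) simp
  moreover have "(h * (u - ray s) - h * (u - ray t)) / 2 = h * ((ray t - ray s) / 2)"
    "(h * (u - ray s) + h * (u - ray t)) / 2 = h * (u - (ray s + ray t) / 2)"
    by (simp_all add: field_simps)
  moreover have "sin (h * ((ray t - ray s) / 2)) \<noteq> 0"
  proof -
    have pos: "sin (h * ((ray b - ray a) / 2)) > 0" if "0 \<le> a" "a < b" "b < 2 * int k" for a b
      using ray_less[OF that] n_ge_3 by (intro sin_h_pos) (simp_all add: field_simps)
    show ?thesis
    proof (cases "s < t")
      case False
      have "h * ((ray t - ray s) / 2) = - (h * ((ray s - ray t) / 2))" by (simp add: field_simps)
      then have "sin (h * ((ray t - ray s) / 2)) = - sin (h * ((ray s - ray t) / 2))"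
        by (simp only: sin_minus)
      then show ?thesis using pos[of t s] False assms by simp
    qed (use pos[of s t] assms in simp)
  qed
  ultimately show ?thesis by simp
qed

lemma not_three_red:
  assumes "F i P = 0" "F j P = 0" "F l P = 0" "i \<in> {0..<n}" "j \<in> {0..<n}" "l \<in> {0..<n}"
    "i \<noteq> j" "i \<noteq> l" "j \<noteq> l"
  shows False
proof -
  obtain r u where P: "r \<ge> 0" "P = pt r u" using exists_pt by metis
  have "sin (h * (u - of_int (i + j))) = 0" "sin (h * (u - of_int (i + l))) = 0"
    using assms P two_red by simp_all
  then have "sin (h * (u - of_int (i + j)) - h * (u - of_int (i + l))) = 0"
    unfolding sin_diff by simp
  moreover have "h * (u - of_int (i + j)) - h * (u - of_int (i + l)) = h * of_int (l - j)"
    by (simp add: algebra_simps)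
  ultimately have "n dvd l - j" using sin_h_int_zero_iff by metis
  then show False using assms by (simp flip: mod_eq_dvd_iff)
qed

text \<open>Outside the open unit disc a blue line stays too close to its rays to reach an integer
  angle.\<close>

lemma not_two_red_one_blue:
  assumes "F i P = 0" "F j P = 0" "G s P = 0" "i \<in> {0..<n}" "j \<in> {0..<n}" "i \<noteq> j"
  shows False
proof -
  obtain r u where P: "r \<ge> 0" "P = pt r u" using exists_pt by metis
  have "sin (h * (u - of_int (i + j))) = 0" using assms P two_red by simp
  then obtain m where "u - of_int (i + j) = of_int (n * m)" using sin_h_zero_iff by blast
  then have "u = of_int (i + j + n * m)" by simp
  then have "eps < \<bar>sin (h * (u - ray s))\<bar>" using eps_less_sin_int_ray by metis
  moreover have "r \<ge> 1" using F_pos_imp[of i r u] assms(1) P by simp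
  ultimately show False using abs_sin_le_eps[of r s u] assms(3) P by simp
qed

text \<open>Blue lines cross each other inside the open unit disc, which no red line enters: the
  crossing is too far in angle from either ray.\<close>

lemma not_one_red_two_blue:
  assumes "F i P = 0" "G s P = 0" "G t P = 0" "s \<in> {0..<2 * int k}" "t \<in> {0..<2 * int k}" "s < t"
  shows False
proof -
  obtain r u where P: "r \<ge> 0" "P = pt r u" using exists_pt by metis
  define A where "A = h * (u - (ray s + ray t) / 2)"
  define B where "B = h * ((ray t - ray s) / 2)"
  have A: "cos A = 0" using two_blue[of s r u t] assms P by (simp add: A_def)
  then have "\<bar>sin A\<bar> = 1" using sin_cos_squared_add[of A] by (simp add: abs_square_eq_1)
  moreover have "h * (u - ray s) = A + B" by (simp add: A_def B_def field_simps)
  ultimately have "\<bar>sin (h * (u - ray s))\<bar> = \<bar>cos B\<bar>" using A by (simp add: sin_add abs_mult)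
  moreover have "cos B = sin (h * (of_int n / 2 - (ray t - ray s) / 2))"
    using h_n by (simp add: B_def right_diff_distrib sin_diff)
  moreover have "\<dots> > eps"
  proof -
    have "ray s < ray t" "ray t - ray s \<le> of_int n - 1" using ray_less[of s t] assms by simp_all
    moreover have "real_of_int n \<ge> 3" using n_ge_3 by simp
    ultimately show ?thesis by (intro sin_h_gt_eps) (simp_all add: field_simps)
  qed
  moreover have "r \<ge> 1" using F_pos_imp[of i r u] assms(1) P by simp
  ultimately show False using abs_sin_le_eps[of r s u] assms(2) P by simp
qed

lemma not_three_blue:
  assumes "G s P = 0" "G t P = 0" "G v P = 0" "s \<in> {0..<2 * int k}" "t \<in> {0..<2 * int k}" "v \<in> {0..<2 * int k}"
    "s \<noteq> t" "s \<noteq> v" "t < v"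
  shows False
proof -
  obtain r u where P: "r \<ge> 0" "P = pt r u" using exists_pt by metis
  define A B where "A = h * (u - (ray s + ray t) / 2)" and "B = h * (u - (ray s + ray v) / 2)"
  have "cos A = 0" "cos B = 0" using two_blue assms P by (simp_all add: A_def B_def)
  then have "sin (A - B) = 0" by (simp add: sin_diff)
  moreover have "A - B = h * ((ray v - ray t) / 2)" by (simp add: A_def B_def field_simps)
  moreover have "sin (h * ((ray v - ray t) / 2)) > 0"
    using ray_less[of t v] assms n_ge_3 by (intro sin_h_pos) auto
  ultimately show False by simp
qed

lemma not_three_concurrent:
  assumes "x \<in> idx" "y \<in> idx" "z \<in> idx" "x \<noteq> y" "x \<noteq> z" "y \<noteq> z"
    "P \<in> line x" "P \<in> line y" "P \<in> line z"
  shows False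
proof -
  have GG: False if "F i P = 0" "G s P = 0" "G t P = 0" "s \<in> {0..<2 * int k}" "t \<in> {0..<2 * int k}" "s \<noteq> t"
    for i s t
    using not_one_red_two_blue[of i P s t] not_one_red_two_blue[of i P t s] that by (cases "s < t") auto
  have GGG: False if "G s P = 0" "G t P = 0" "G v P = 0" "s \<in> {0..<2 * int k}" "t \<in> {0..<2 * int k}"
    "v \<in> {0..<2 * int k}" "s \<noteq> t" "s \<noteq> v" "t \<noteq> v" for s t v
    using not_three_blue[of s P t v] not_three_blue[of s P v t] that by (cases "t < v") auto
  have coord: "(\<forall>i. w = Inl i \<longrightarrow> i \<in> {0..<n} \<and> F i P = 0) \<and>
      (\<forall>s. w = Inr s \<longrightarrow> s \<in> {0..<2 * int k} \<and> G s P = 0)" if "w \<in> idx" "P \<in> line w" for w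
    using that by (auto simp: idx_def mem_line)
  note coords = coord[OF assms(1,7)] coord[OF assms(2,8)] coord[OF assms(3,9)]
  show False
  proof (cases x)
    case x: (Inl i)
    show False
    proof (cases y)
      case y: (Inl j)
      show False
      proof (cases z)
        case (Inl l)
        then show False using x y coords assms(4-6) not_three_red[of i P j l] by simp
      next
        case (Inr l)
        then show False using x y coords assms(4-6) not_two_red_one_blue[of i P j l] by simp
      qed
    next
      case y: (Inr j)
      show False
      proof (cases z)
        case (Inl l)
        then show False using x y coords assms(4-6) not_two_red_one_blue[of i P l j] by simp
      next
        case (Inr l)
        then show False using x y coords assms(4-6) GG[of i j l] by simp
      qed
    qed
  next
    case x: (Inr i)
    show False
    proof (cases y)
      case y: (Inl j)
      show False
      proof (cases z)
        case (Inl l)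
        then show False using x y coords assms(4-6) not_two_red_one_blue[of j P l i] by simp
      next
        case (Inr l)
        then show False using x y coords assms(4-6) GG[of j i l] by simp
      qed
    next
      case y: (Inr j)
      show False
      proof (cases z)
        case (Inl l)
        then show False using x y coords assms(4-6) GG[of l i j] by simp
      next
        case (Inr l)
        then show False using x y coords assms(4-6) GGG[of i j l] by simp
      qed
    qed
  qed
qed

lemma not_affine_parallel_line:
  assumes "x \<in> idx" "y \<in> idx" "x \<noteq> y"
  shows "\<not> affine_parallel (line x) (line y)"
proof -
  have RR: "sin (2 * h * of_int i - 2 * h * of_int j) \<noteq> 0" if "i \<in> {0..<n}" "j \<in> {0..<n}" "i \<noteq> j" for i j
  proof
    assume "sin (2 * h * of_int i - 2 * h * of_int j) = 0"
    moreover have "2 * h * of_int i - 2 * h * of_int j = h * of_int (2 * (i - j))" by (simp add: algebra_simps)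
    ultimately have "n dvd 2 * (i - j)" using sin_h_int_zero_iff by metis
    \<comment> \<open>A regular polygon with an odd number of sides has no parallel sides.\<close>
    moreover have "coprime n 2" using odd_n by simp
    ultimately have "n dvd i - j" using coprime_dvd_mult_right_iff by blast
    then show False using that by (simp flip: mod_eq_dvd_iff)
  qed
  have BB: "sin ((h * ray s + pi / 2) - (h * ray t + pi / 2)) \<noteq> 0"
    if "s \<in> {0..<2 * int k}" "t \<in> {0..<2 * int k}" "s \<noteq> t" for s t
  proof (cases "s < t")
    case True
    then show ?thesis using sin_h_pos[of "ray t - ray s"] ray_less[of s t] that
      sin_minus[of "h * (ray t - ray s)"] by (auto simp: algebra_simps)
  next
    case False
    then show ?thesis using sin_h_pos[of "ray s - ray t"] ray_less[of t s] that
      by (auto simp: algebra_simps)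
  qed
  have RB: "cos (h * (2 * of_int i - ray s)) \<noteq> 0" for i s
  proof
    assume "cos (h * (2 * of_int i - ray s)) = 0"
    then have "sin (2 * (h * (2 * of_int i - ray s))) = 0" by (simp add: sin_double)
    then have "sin (h * (2 * (2 * of_int i - ray s))) = 0" by (simp add: mult.left_commute)
    then obtain m where "2 * (2 * of_int i - ray s) = of_int (n * m)" using sin_h_zero_iff by blast
    \<comment> \<open>The thirds in \<open>ray\<close> pay off: modulo three the left side vanishes,
      whereas the right side is 2 or 4.\<close>
    then have "real_of_int (3 * (4 * i - 6 * (s div 2) - n * m)) = of_int (2 + 2 * (s mod 2))"
      by (simp add: ray_def field_simps)
    then have "3 * (4 * i - 6 * (s div 2) - n * m) = 2 + 2 * (s mod 2)" by (simp only: of_int_eq_iff)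
    then have "3 dvd 2 + 2 * (s mod 2)" by (metis dvd_triv_left)
    then show False by presburger
  qed
  have RB': "sin (2 * h * of_int i - (h * ray s + pi / 2)) \<noteq> 0" "sin ((h * ray s + pi / 2) - 2 * h * of_int i) \<noteq> 0" for i s
  proof -
    have "2 * h * of_int i - (h * ray s + pi / 2) = h * (2 * of_int i - ray s) - pi / 2"
      by (simp add: algebra_simps)
    then have "sin (2 * h * of_int i - (h * ray s + pi / 2)) = - cos (h * (2 * of_int i - ray s))"
      by (simp only: sin_diff) simp
    then show 1: "sin (2 * h * of_int i - (h * ray s + pi / 2)) \<noteq> 0" using RB by simp
    then show "sin ((h * ray s + pi / 2) - 2 * h * of_int i) \<noteq> 0"
      using sin_minus[of "2 * h * of_int i - (h * ray s + pi / 2)"] by simp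
  qed
  have "sin (angle x - angle y) \<noteq> 0"
  proof (cases x)
    case x: (Inl i)
    show ?thesis
    proof (cases y)
      case (Inl j)
      then show ?thesis using RR[of i j] assms x unfolding angle_def by (auto simp: idx_def)
    next
      case (Inr t)
      then show ?thesis using RB'(1)[of i t] x unfolding angle_def by simp
    qed
  next
    case x: (Inr s)
    show ?thesis
    proof (cases y)
      case (Inl j)
      then show ?thesis using RB'(2)[of s j] x unfolding angle_def by simp
    next
      case (Inr t)
      then show ?thesis using BB[of s t] assms x unfolding angle_def by (auto simp: idx_def)
    qed
  qed
  then show ?thesis unfolding line_def normal_def by (rule not_affine_parallel_hyperplane_dirv)
qed

lemma inj_on_line: "inj_on line idx"
proof
  fix x y assume xy: "x \<in> idx" "y \<in> idx" "line x = line y"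
  have "affine_parallel (line x) (line y)" unfolding xy(3) affine_parallel_def by (intro exI[of _ 0]) simp
  then show "x = y" using not_affine_parallel_line xy by blast
qed

lemma simple_arrangement_lines: "simple_arrangement (line ` idx)"
proof -
  have "finite idx" by (simp add: idx_def)
  moreover have "is_line (line x)" for x
    by (simp add: line_def normal_def is_line_hyperplane_dirv)
  moreover have "pairwise (\<lambda>l m. \<not> affine_parallel l m) (line ` idx)"
    using not_affine_parallel_line by (auto simp: pairwise_def)
  moreover have "card {l \<in> line ` idx. p \<in> l} \<le> 2" for p
  proof (rule ccontr)
    assume "\<not> ?thesis"
    then have "3 \<le> card {l \<in> line ` idx. p \<in> l}" by simp
    then obtain S where S: "S \<subseteq> {l \<in> line ` idx. p \<in> l}" "card S = 3"
      by (rule obtain_subset_with_card_n)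
    then obtain a b c where "S = {a, b, c}" "a \<noteq> b" "a \<noteq> c" "b \<noteq> c" using card_3_iff by metis
    then have "\<exists>x y z. x \<in> idx \<and> y \<in> idx \<and> z \<in> idx \<and> x \<noteq> y \<and> x \<noteq> z \<and> y \<noteq> z \<and>
        p \<in> line x \<and> p \<in> line y \<and> p \<in> line z" using S(1) by auto
    then show False using not_three_concurrent by blast
  qed
  ultimately show ?thesis by (simp add: simple_arrangement_def line_arrangement_def)
qed

subsection \<open>Crossing steps\<close>

text \<open>\<open>Q\<close> is a point of the crossed edge, on red line \<open>i\<close> and no
  other red line. Its angle is what \<open>no_hop\<close> examines.\<close>

definition red_step :: "plane \<Rightarrow> plane \<Rightarrow> bool" where
  "red_step P P' \<longleftrightarrow> Ys P = Ys P' \<and> (\<exists>i\<in>{0..<n}. (i \<in> Xs P \<longleftrightarrow> i \<notin> Xs P') \<and>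
     (\<exists>Q. Ys Q = Ys P \<and> Xs P - {i} = Xs Q \<and> Xs P' - {i} = Xs Q \<and>
        (\<forall>j. F j Q = 0 \<longleftrightarrow> j mod n = i)))"

definition blue_step :: "plane \<Rightarrow> plane \<Rightarrow> bool" where
  "blue_step P P' \<longleftrightarrow> Xs P = Xs P' \<and>
     (\<exists>s. (s \<in> Ys P \<longleftrightarrow> s \<notin> Ys P') \<and> Ys P - {s} = Ys P' - {s})"

lemma mem_pos_set:
  "Inl i \<in> pos_set idx normal offset P \<longleftrightarrow> i \<in> Xs P"
  "Inr s \<in> pos_set idx normal offset P \<longleftrightarrow> s \<in> Ys P"
  by (auto simp: pos_set_def idx_def Xs_def Ys_def F_eq G_eq)

lemma pos_set_eq_iff:
  "pos_set idx normal offset P = pos_set idx normal offset P' \<longleftrightarrow> Xs P = Xs P' \<and> Ys P = Ys P'"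
proof -
  have "Xs P = Inl -` pos_set idx normal offset P" "Ys P = Inr -` pos_set idx normal offset P" for P
    by (auto simp: mem_pos_set)
  moreover have "pos_set idx normal offset P = Inl ` Xs P \<union> Inr ` Ys P" for P
    by (auto simp: pos_set_def idx_def Xs_def Ys_def F_eq G_eq)
  ultimately show ?thesis by metis
qed

lemma crossing_red_step:
  assumes "crossing idx normal offset (Inl i) P P'"
  shows "red_step P P'"
proof -
  have i: "i \<in> {0..<n}" "i \<in> Xs P \<longleftrightarrow> i \<notin> Xs P'"
    using assms unfolding crossing_def mem_pos_set by (auto simp: idx_def)
  obtain Q where Q: "normal (Inl i) \<bullet> Q = offset (Inl i)"
    "\<forall>j\<in>idx. j \<noteq> Inl i \<longrightarrow> normal j \<bullet> Q \<noteq> offset j"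
    "pos_set idx normal offset P - {Inl i} = pos_set idx normal offset Q"
    "pos_set idx normal offset P' - {Inl i} = pos_set idx normal offset Q"
    using assms unfolding crossing_def by blast
  have "x \<in> Xs R - {i} \<longleftrightarrow> x \<in> Xs Q" "x \<in> Ys R \<longleftrightarrow> x \<in> Ys Q"
    if "pos_set idx normal offset R - {Inl i} = pos_set idx normal offset Q" for x R
    unfolding mem_pos_set[of _ Q, symmetric] that[symmetric] by (auto simp: mem_pos_set)
  from this[OF Q(3)] this[OF Q(4)]
have "Xs P - {i} = Xs Q" "Xs P' - {i} = Xs Q" "Ys P = Ys Q" "Ys P' = Ys Q" by blast+
  moreover have "F j Q = 0 \<longleftrightarrow> j mod n = i" for j
  proof
    assume "F j Q = 0"
    then have "normal (Inl (j mod n)) \<bullet> Q = offset (Inl (j mod n))" using F_mod[of j Q] F_eq by simp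
    moreover have "Inl (j mod n) \<in> idx" using n_ge_3 by (simp add: idx_def)
    ultimately show "j mod n = i" using Q(2) by blast
  next
    assume "j mod n = i"
    then show "F j Q = 0" using Q(1) F_mod[of j Q] F_eq by simp
  qed
  ultimately show ?thesis unfolding red_step_def using i by metis
qed

lemma crossing_blue_step:
  assumes "crossing idx normal offset (Inr s) P P'"
  shows "blue_step P P'"
proof -
  have s: "s \<in> Ys P \<longleftrightarrow> s \<notin> Ys P'"
    using assms unfolding crossing_def mem_pos_set by blast
  have eq: "pos_set idx normal offset P - {Inr s} = pos_set idx normal offset P' - {Inr s}"
    using assms unfolding crossing_def by auto
  have "Inl x \<in> pos_set idx normal offset P - {Inr s} \<longleftrightarrow> Inl x \<in> pos_set idx normal offset P' - {Inr s}"
    "Inr x \<in> pos_set idx normal offset P - {Inr s} \<longleftrightarrow> Inr x \<in> pos_set idx normal offset P' - {Inr s}" for x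
    unfolding eq by blast+
  then have "x \<in> Xs P \<longleftrightarrow> x \<in> Xs P'" "x \<in> Ys P - {s} \<longleftrightarrow> x \<in> Ys P' - {s}" for x
    by (auto simp: mem_pos_set)
  then show ?thesis unfolding blue_step_def using s by blast
qed

lemma red_step_sym: "red_step P P' \<Longrightarrow> red_step P' P"
  unfolding red_step_def by (elim conjE bexE exE, intro conjI bexI exI) auto

lemma blue_step_sym: "blue_step P P' \<Longrightarrow> blue_step P' P"
  unfolding blue_step_def by auto

lemma card_toggle:
  assumes "finite A" "finite B" "x \<in> A \<longleftrightarrow> x \<notin> B" "A - {x} = B - {x}"
  shows "card A = Suc (card B) \<or> card B = Suc (card A)"
proof (cases "x \<in> A")
  case True
  then have "A = insert x B" "x \<notin> B" using assms by auto
  then show ?thesis using assms by simp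
next
  case False
  then have "B = insert x A" using assms by auto
  then show ?thesis using assms False by simp
qed

lemma red_step_card:
  assumes "red_step P P'"
  shows "Ys P = Ys P'" "card (Xs P) = Suc (card (Xs P')) \<or> card (Xs P') = Suc (card (Xs P))"
proof -
  show "Ys P = Ys P'" using assms by (simp add: red_step_def)
  obtain i Q where "i \<in> Xs P \<longleftrightarrow> i \<notin> Xs P'" "Xs P - {i} = Xs Q" "Xs P' - {i} = Xs Q"
    using assms unfolding red_step_def by blast
  then show "card (Xs P) = Suc (card (Xs P')) \<or> card (Xs P') = Suc (card (Xs P))"
    using card_toggle[of "Xs P" "Xs P'" i] finite_Xs by simp
qed

lemma blue_step_card:
  assumes "blue_step P P'"
  shows "Xs P = Xs P'" "card (Ys P) = Suc (card (Ys P')) \<or> card (Ys P') = Suc (card (Ys P))"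
proof -
  show "Xs P = Xs P'" using assms by (simp add: blue_step_def)
  obtain s where "s \<in> Ys P \<longleftrightarrow> s \<notin> Ys P'" "Ys P - {s} = Ys P' - {s}"
    using assms unfolding blue_step_def by blast
  then show "card (Ys P) = Suc (card (Ys P')) \<or> card (Ys P') = Suc (card (Ys P))"
    using card_toggle[of "Ys P" "Ys P'" s] finite_Ys by simp
qed

section \<open>From sign sets back to cells, and the impossibility of hops\<close>

lemma visible_pt:
  assumes "Xs P \<noteq> {}"
  obtains r u where "r > 1" "0 < u" "u \<le> 2 * of_int n" "P = pt r u"
proof -
  obtain r u where ru: "r \<ge> 0" "0 < u" "u \<le> 0 + 2 * of_int n" "P = pt r u" using exists_pt by metis
  obtain i where "F i P > 0" using assms by (auto simp: Xs_def)
  then have "r > 1" using ru F_pos_imp_gt by blast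
  then show thesis using that ru by auto
qed

lemma W_odd_inj:
  assumes "W (2 * q + 1) = W (2 * q' + 1)" "0 \<le> q" "q < 2 * int k" "0 \<le> q'" "q' < 2 * int k"
  shows "q = q'"
proof -
  have zero: "0 \<in> W (2 * q + 1) \<longleftrightarrow> 2 * q + 1 \<le> 2 * int k" if "0 \<le> q" for q
    using that k_pos by (auto simp: W_def)
  have "2 * q + 1 \<le> 2 * int k \<longleftrightarrow> 2 * q' + 1 \<le> 2 * int k"
    using zero[of q] zero[of q'] assms by simp
  moreover have "int (card (W (2 * q + 1))) = int (card (W (2 * q' + 1)))" using assms(1) by simp
  then have "(if 2 * q + 1 \<le> 2 * int k then 2 * q + 1 else 4 * int k - (2 * q + 1)) =
      (if 2 * q' + 1 \<le> 2 * int k then 2 * q' + 1 else 4 * int k - (2 * q' + 1))"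
    using assms by (subst (asm) (1 2) card_W) auto
  ultimately show ?thesis by (auto split: if_splits)
qed

text \<open>A visible line puts the points outside the unit circle, where an odd \<open>|Y|\<close>
  names the cell; inside a cell the visible sets form a chain.\<close>

lemma Xs_determined:
  assumes "Ys P = Ys P'" "odd (card (Ys P))" "card (Xs P) = card (Xs P')" "Xs P \<noteq> {}"
  shows "Xs P = Xs P'"
proof -
  have "Xs P' \<noteq> {}" using assms(3,4) finite_Xs by auto
  then obtain r u r' u' where P: "r > 1" "0 < u" "u \<le> 2 * of_int n" "P = pt r u"
    and P': "r' > 1" "0 < u'" "u' \<le> 2 * of_int n" "P' = pt r' u'"
    using visible_pt assms(4) by metis
  obtain q where q: "0 \<le> q" "q < 2 * int k" "3 * of_int q < u" "u < 3 * of_int q + 1" "Ys P = W (2 * q + 1)"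
    using odd_Ys_cell[OF P(1-3)] assms(2) P(4) by metis
  obtain q' where q': "0 \<le> q'" "q' < 2 * int k" "3 * of_int q' < u'" "u' < 3 * of_int q' + 1" "Ys P' = W (2 * q' + 1)"
    using odd_Ys_cell[OF P'(1-3)] assms(1,2) P'(4) by metis
  have "q = q'" using W_odd_inj[of q q'] q q' assms(1) by simp
  then show ?thesis
    using Xs_eq_in_cell[of r r' "3 * q" u u'] P P' q q' assms(3) by simp
qed

text \<open>For \<open>u \<ge> 3q - 1\<close> the axes \<open>3q - 2\<close> and
  \<open>3q - 1\<close> separate \<open>Q\<close> from the first cell; otherwise
  \<open>3q - 1\<close> and \<open>3q\<close> separate it from the second. By
  \<open>visible_all_if_reflections\<close> all red lines would then be visible from that cell,
  against \<open>card_Xs_le\<close>.\<close>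

lemma no_hop:
  assumes Pa: "Xs (pt ra ua) \<noteq> {}" "ra \<ge> 0" "3 * of_int q - 3 < ua" "ua < 3 * of_int q - 2"
    and Pb: "Xs (pt rb ub) \<noteq> {}" "rb \<ge> 0" "3 * of_int q < ub" "ub < 3 * of_int q + 1"
    and Q: "r \<ge> 0" "3 * of_int q - 3 < u" "u < 3 * of_int q + 1"
    and i: "\<And>j. F j (pt r u) = 0 \<longleftrightarrow> j mod n = i"
    and Xs: "Xs (pt ra ua) - {i} = Xs (pt r u)" "Xs (pt rb ub) - {i} = Xs (pt r u)"
  shows False
proof -
  have n3: "real_of_int n \<ge> 3" using n_ge_3 by simp
  have sub: "F j (pt r u) > 0 \<Longrightarrow> F j P > 0" "F j P > 0 \<Longrightarrow> F j (pt r u) \<ge> 0"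
    if "Xs P - {i} = Xs (pt r u)" for j P
  proof -
    show "F j (pt r u) > 0 \<Longrightarrow> F j P > 0" using that by (auto simp: F_pos_iff_Xs)
    show "F j P > 0 \<Longrightarrow> F j (pt r u) \<ge> 0"
      using that i[of j] F_pos_iff_Xs[of j P] F_pos_iff_Xs[of j "pt r u"] by fastforce
  qed
  have not_all: "\<not> (\<forall>j. F j P > 0)" for P
  proof
    assume "\<forall>j. F j P > 0"
    then have "Xs P = {0..<n}" by (auto simp: Xs_def)
    then show False using card_Xs_le[of P] n_ge_3 by simp
  qed
  show False
  proof (cases "u \<ge> 3 * of_int q - 1")
    case True
    obtain j0 where j0: "F j0 (pt ra ua) > 0" using Pa(1) by (auto simp: Xs_def)
    have sides: "sin (h * (ua - of_int s)) \<le> 0 \<and> sin (h * (u - of_int s)) \<ge> 0"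
      if "s \<in> {3 * q - 2, 3 * q - 2 + 1}" for s
      using that Pa Q True n3 by (intro conjI sin_h_nonpos sin_h_nonneg) auto
    have "F j (pt ra ua) > 0" for j
    proof (rule visible_all_if_reflections[OF Pa(2) Q(1) refl refl _ sub[OF Xs(1)] _ j0])
      show "s \<in> {3 * q - 2, 3 * q - 2 + 1} \<Longrightarrow>
        (sin (h * (ua - of_int s)) \<le> 0 \<and> sin (h * (u - of_int s)) \<ge> 0) \<or>
        (sin (h * (ua - of_int s)) \<ge> 0 \<and> sin (h * (u - of_int s)) \<le> 0)" for s
        using sides by blast
      show "F a (pt r u) = 0 \<Longrightarrow> F b (pt r u) = 0 \<Longrightarrow> a mod n = b mod n" for a b
        using i by simp
    qed
    then show False using not_all by blast
  next
    case False
    obtain j0 where j0: "F j0 (pt rb ub) > 0" using Pb(1) by (auto simp: Xs_def)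
    have sides: "sin (h * (ub - of_int s)) \<ge> 0 \<and> sin (h * (u - of_int s)) \<le> 0"
      if "s \<in> {3 * q - 1, 3 * q - 1 + 1}" for s
      using that Pb Q False n3 by (intro conjI sin_h_nonpos sin_h_nonneg) auto
    have "F j (pt rb ub) > 0" for j
    proof (rule visible_all_if_reflections[OF Pb(2) Q(1) refl refl _ sub[OF Xs(2)] _ j0])
      show "s \<in> {3 * q - 1, 3 * q - 1 + 1} \<Longrightarrow>
        (sin (h * (ub - of_int s)) \<le> 0 \<and> sin (h * (u - of_int s)) \<ge> 0) \<or>
        (sin (h * (ub - of_int s)) \<ge> 0 \<and> sin (h * (u - of_int s)) \<le> 0)" for s
        using sides by blast
      show "F a (pt r u) = 0 \<Longrightarrow> F b (pt r u) = 0 \<Longrightarrow> a mod n = b mod n" for a b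
        using i by simp
    qed
    then show False using not_all by blast
  qed
qed

text \<open>The bound \<open>card (Xs P2) \<ge> 2\<close> leaves a visible line at the edge point
  \<open>Q\<close>, so \<open>Q\<close> lies outside the unit circle and in a known sector. Both
  ends lie in cells bordering this sector, and \<open>no_hop\<close> forbids that these be
  different.\<close>

lemma four_steps_same_road:
  assumes steps: "blue_step P1 P2" "red_step P2 P3" "blue_step P3 P4"
    and odd: "odd (card (Ys P1))" "odd (card (Ys P4))"
    and ne: "card (Xs P2) \<ge> 2" "Xs P3 \<noteq> {}"
  shows "Ys P1 = Ys P4"
proof (rule ccontr)
  assume neq: "Ys P1 \<noteq> Ys P4"
  have X: "Xs P1 = Xs P2" "Xs P3 = Xs P4" and Y: "Ys P2 = Ys P3"
    using steps blue_step_card red_step_card by blast+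
  obtain i Q where i: "i \<in> {0..<n}" "Ys Q = Ys P2" "Xs P2 - {i} = Xs Q" "Xs P3 - {i} = Xs Q"
    "\<And>j. F j Q = 0 \<longleftrightarrow> j mod n = i"
    using steps(2) unfolding red_step_def by blast
  have "Xs Q \<noteq> {}"
  proof
    assume "Xs Q = {}"
    then have "Xs P2 \<subseteq> {i}" using i(3) by blast
    then have "card (Xs P2) \<le> 1" using card_mono[of "{i}" "Xs P2"] by simp
    then show False using ne(1) by simp
  qed
  then obtain r0 u0 where Q0: "r0 > 1" "0 < u0" "u0 \<le> 2 * of_int n" "Q = pt r0 u0" using visible_pt by blast
  have "even (card (Ys Q))" using blue_step_card(2)[OF steps(1)] odd(1) i(2) by auto
  then obtain q u where q: "1 \<le> q" "q \<le> 2 * int k" "3 * of_int q - 3 < u" "u < 3 * of_int q + 1"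
    "Ys Q = W (2 * q)" "Q = pt r0 u"
    using even_Ys_sector[OF Q0(1-3)] Q0(4) by metis
  have cell: "\<exists>p r u. r > 1 \<and> P = pt r u \<and> 0 \<le> p \<and> p < 2 * int k \<and> 3 * of_int p < u \<and> u < 3 * of_int p + 1 \<and>
      Ys P = W (2 * p + 1) \<and> (q = p \<or> q = p + 1 \<or> (p = 0 \<and> q = 2 * int k))"
    if P: "Xs P \<noteq> {}" "odd (card (Ys P))" "blue_step P P'" "Ys P' = Ys Q" for P P'
  proof -
    obtain r u where ru: "r > 1" "0 < u" "u \<le> 2 * of_int n" "P = pt r u" using visible_pt P(1) by blast
    obtain p where p: "0 \<le> p" "p < 2 * int k" "3 * of_int p < u" "u < 3 * of_int p + 1" "Ys P = W (2 * p + 1)"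
      using odd_Ys_cell[OF ru(1-3)] P(2) ru(4) by metis
    obtain s where "s \<in> Ys P \<longleftrightarrow> s \<notin> Ys P'" "Ys P - {s} = Ys P' - {s}"
      using P(3) unfolding blue_step_def by blast
    then have "(s \<notin> Ys P' \<and> Ys P = insert s (Ys P')) \<or> (s \<notin> Ys P \<and> Ys P' = insert s (Ys P))" by blast
    then have "q = p \<or> q = p + 1 \<or> (p = 0 \<and> q = 2 * int k)"
      using W_adjacent[OF p(1,2) q(1,2)] p(5) q(5) P(4) by simp
    then show ?thesis using ru p by blast
  qed
  have "Xs P1 \<noteq> {}" using ne(1) X(1) by auto
  then obtain p1 r1 u1 where 1: "r1 > 1" "P1 = pt r1 u1" "0 \<le> p1" "p1 < 2 * int k" "3 * of_int p1 < u1"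
      "u1 < 3 * of_int p1 + 1" "Ys P1 = W (2 * p1 + 1)" "q = p1 \<or> q = p1 + 1 \<or> (p1 = 0 \<and> q = 2 * int k)"
    using cell[OF _ odd(1) steps(1)] i(2) by metis
  have "Xs P4 \<noteq> {}" using ne(2) X(2) by auto
  then obtain p4 r4 u4 where 4: "r4 > 1" "P4 = pt r4 u4" "0 \<le> p4" "p4 < 2 * int k" "3 * of_int p4 < u4"
      "u4 < 3 * of_int p4 + 1" "Ys P4 = W (2 * p4 + 1)" "q = p4 \<or> q = p4 + 1 \<or> (p4 = 0 \<and> q = 2 * int k)"
    using cell[OF _ odd(2) blue_step_sym[OF steps(3)]] i(2) Y by metis
  have n: "real_of_int n = 3 * real k" by (simp add: n_def)
  have before: "3 * of_int q - 3 < u" "u < 3 * of_int q - 2" if "q = p + 1" "3 * of_int p < u" "u < 3 * of_int p + 1" for p :: int and u :: real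
    using that by auto
  \<comment> \<open>Cell 0 follows the last gap; a full turn makes its angles larger than those of
    the gap.\<close>
  have after: "\<exists>u'. pt r u = pt r u' \<and> 3 * of_int q < u' \<and> u' < 3 * of_int q + 1"
    if "q = p \<or> (p = 0 \<and> q = 2 * int k)" "3 * of_int p < u" "u < 3 * of_int p + 1" for p :: int and r u :: real
    using that pt_shift[of r u] n by (elim disjE conjE) (force, (intro exI[of _ "u + 2 * of_int n"], simp))
  have "p1 \<noteq> p4" using neq 1 4 by auto
  then consider "q = p1 + 1" "q = p4 \<or> (p4 = 0 \<and> q = 2 * int k)" | "q = p4 + 1" "q = p1 \<or> (p1 = 0 \<and> q = 2 * int k)"
    using 1(3,4,8) 4(3,4,8) by linarith
  then show False
  proof cases
    case c: 1
    obtain u' where "P4 = pt r4 u'" "3 * of_int q < u'" "u' < 3 * of_int q + 1"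
      using after[OF c(2) 4(5,6)] 4(2) by metis
    then show False
      using no_hop[of r1 u1 q r4 u' r0 u i] before[OF c(1) 1(5,6)] 1 4 q Q0(1) i X \<open>Xs P1 \<noteq> {}\<close> \<open>Xs P4 \<noteq> {}\<close> by simp
  next
    case 2
    obtain u' where "P1 = pt r1 u'" "3 * of_int q < u'" "u' < 3 * of_int q + 1"
      using after[OF 2(2) 1(5,6)] 1(2) by metis
    then show False
      using no_hop[of r4 u4 q r1 u' r0 u i] before[OF 2(1) 4(5,6)] 1 4 q Q0(1) i X \<open>Xs P1 \<noteq> {}\<close> \<open>Xs P4 \<noteq> {}\<close> by simp
  qed
qed

subsection \<open>Length of alternating walks\<close>

abbreviation xc :: "plane \<Rightarrow> nat" where "xc P \<equiv> card (Xs P)"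

abbreviation yc :: "plane \<Rightarrow> nat" where "yc P \<equiv> card (Ys P)"

text \<open>All that the counting needs of a path. \<open>red j\<close> is the colour of the step
  from \<open>j\<close> to \<open>Suc j\<close>.\<close>

definition walk :: "nat \<Rightarrow> (nat \<Rightarrow> plane) \<Rightarrow> (nat \<Rightarrow> bool) \<Rightarrow> bool" where
  "walk L p red \<longleftrightarrow>
     (\<forall>i j. i < j \<longrightarrow> j < L \<longrightarrow> Xs (p i) \<noteq> Xs (p j) \<or> Ys (p i) \<noteq> Ys (p j)) \<and>
     (\<forall>j. Suc j < L \<longrightarrow> (if red j then red_step (p j) (p (Suc j)) else blue_step (p j) (p (Suc j)))) \<and>
     (\<forall>j. Suc (Suc j) < L \<longrightarrow> red j \<noteq> red (Suc j))"

lemma walk_step: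
  assumes "walk L p red" "Suc j < L"
  shows "red j \<Longrightarrow> red_step (p j) (p (Suc j))" "\<not> red j \<Longrightarrow> blue_step (p j) (p (Suc j))"
  using assms unfolding walk_def by presburger+

lemma walk_distinct:
  assumes "walk L p red" "i < j" "j < L" "Xs (p i) = Xs (p j)"
  shows "Ys (p i) \<noteq> Ys (p j)"
  using assms unfolding walk_def by blast

text \<open>The number of steps is one less than the number of faces, hence \<open>L - 2 - j\<close>
  for steps and \<open>L - 1 - j\<close> for faces.\<close>

lemma walk_rev:
  assumes "walk L p red"
  shows "walk L (\<lambda>j. p (L - 1 - j)) (\<lambda>j. red (L - 2 - j))"
  unfolding walk_def
proof (intro conjI allI impI)
  show "Xs (p (L - 1 - i)) \<noteq> Xs (p (L - 1 - j)) \<or> Ys (p (L - 1 - i)) \<noteq> Ys (p (L - 1 - j))"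
    if "i < j" "j < L" for i j
  proof -
    have "L - 1 - j < L - 1 - i" "L - 1 - i < L" using that by auto
    then show ?thesis using assms unfolding walk_def by metis
  qed
  show "if red (L - 2 - j) then red_step (p (L - 1 - j)) (p (L - 1 - Suc j))
      else blue_step (p (L - 1 - j)) (p (L - 1 - Suc j))" if "Suc j < L" for j
  proof -
    define i where "i = L - 2 - j"
    have i: "Suc i < L" "L - 1 - j = Suc i" "L - 1 - Suc j = i" "L - 2 - j = i" using that by (auto simp: i_def)
    have "if red i then red_step (p i) (p (Suc i)) else blue_step (p i) (p (Suc i))"
      using assms i(1) unfolding walk_def by blast
    then show ?thesis unfolding i(2-4) using red_step_sym blue_step_sym by (auto split: if_splits)
  qed
  show "red (L - 2 - j) \<noteq> red (L - 2 - Suc j)" if "Suc (Suc j) < L" for j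
  proof -
    define i where "i = L - 2 - Suc j"
    have i: "Suc (Suc i) < L" "L - 2 - j = Suc i" using that by (auto simp: i_def)
    then show ?thesis using assms unfolding walk_def i(2) i_def[symmetric] by metis
  qed
qed

text \<open>A red step flips the parity of \<open>|X|\<close> only and a blue one that of
  \<open>|Y|\<close> only. Among the first \<open>j\<close> steps, \<open>(j + 1) div 2\<close> have
  the colour of step 0.\<close>

lemma walk_parity:
  assumes w: "walk L p red" and "j < L"
  shows "even (xc (p j)) \<longleftrightarrow> even (xc (p 0) + (if red 0 then (j + 1) div 2 else j div 2))"
    and "even (yc (p j)) \<longleftrightarrow> even (yc (p 0) + (if red 0 then j div 2 else (j + 1) div 2))"
    and "Suc j < L \<Longrightarrow> red j \<longleftrightarrow> (even j \<longleftrightarrow> red 0)"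
proof -
  have red: "red j \<longleftrightarrow> (even j \<longleftrightarrow> red 0)" if "Suc j < L" for j
    using that
  proof (induction j)
    case (Suc j)
    then have "red j \<noteq> red (Suc j)" using w unfolding walk_def by blast
    then show ?case using Suc by auto
  qed simp
  then show "Suc j < L \<Longrightarrow> red j \<longleftrightarrow> (even j \<longleftrightarrow> red 0)" .
  have "(even (xc (p j)) \<longleftrightarrow> even (xc (p 0) + (if red 0 then (j + 1) div 2 else j div 2))) \<and>
    (even (yc (p j)) \<longleftrightarrow> even (yc (p 0) + (if red 0 then j div 2 else (j + 1) div 2)))"
    using assms(2)
  proof (induction j)
    case (Suc j)
    then have IH: "even (xc (p j)) \<longleftrightarrow> even (xc (p 0) + (if red 0 then (j + 1) div 2 else j div 2))"
      "even (yc (p j)) \<longleftrightarrow> even (yc (p 0) + (if red 0 then j div 2 else (j + 1) div 2))" by simp_all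
    have step: "if red j then red_step (p j) (p (Suc j)) else blue_step (p j) (p (Suc j))"
      using w Suc.prems unfolding walk_def by blast
    show ?case
    proof (cases "red j")
      case True
      then have "yc (p (Suc j)) = yc (p j)" "even (xc (p (Suc j))) \<longleftrightarrow> odd (xc (p j))"
        using step red_step_card[of "p j" "p (Suc j)"] by auto
      moreover have "even j \<longleftrightarrow> red 0" using True red[of j] Suc.prems by simp
      ultimately show ?thesis
        using IH even_half_step[of j] by (cases "red 0") (simp_all only: even_add if_True if_False, blast+)
    next
      case False
      then have "xc (p (Suc j)) = xc (p j)" "even (yc (p (Suc j))) \<longleftrightarrow> odd (yc (p j))"
        using step blue_step_card[of "p j" "p (Suc j)"] by auto
      moreover have "even j \<longleftrightarrow> \<not> red 0" using False red[of j] Suc.prems by simp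
      ultimately show ?thesis
        using IH even_half_step[of j] by (cases "red 0") (simp_all only: even_add if_True if_False, blast+)
    qed
  qed simp
  then show "even (xc (p j)) \<longleftrightarrow> even (xc (p 0) + (if red 0 then (j + 1) div 2 else j div 2))"
    "even (yc (p j)) \<longleftrightarrow> even (yc (p 0) + (if red 0 then j div 2 else (j + 1) div 2))" by simp_all
qed

text \<open>Only the two red steps change \<open>|X|\<close>, by one each. The first one keeps
  \<open>Ys\<close>, and the other three have the pattern blue, red, blue of
  \<open>four_steps_same_road\<close>.\<close>

lemma walk_block:
  assumes w: "walk L p red" and j: "j + 4 < L" "red j" and odd: "odd (xc (p j))" "odd (yc (p j))" "odd (yc (p (j + 4)))"
  shows "xc (p (j + 4)) \<le> xc (p j) + 2" "xc (p j) \<le> xc (p (j + 4)) + 2"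
    and "xc (p j) \<ge> 3 \<or> xc (p (j + 4)) \<ge> 3 \<Longrightarrow> Ys (p (j + 4)) = Ys (p j)"
    and "xc (p (j + 4)) = xc (p j) + 2 \<Longrightarrow> xc (p (j + 1)) = xc (p j) + 1"
    and "Ys (p (j + 1)) = Ys (p j)"
proof -
  have alt: "red i \<noteq> red (Suc i)" if "Suc (Suc i) < L" for i using w that unfolding walk_def by blast
  have step: "if red i then red_step (p i) (p (Suc i)) else blue_step (p i) (p (Suc i))" if "Suc i < L" for i
    using w that unfolding walk_def by blast
  have r: "red j" "\<not> red (j + 1)" "red (j + 2)" "\<not> red (j + 3)"
    using j alt[of j] alt[of "j + 1"] alt[of "j + 2"] by (auto simp: numeral_eq_Suc)
  have s: "red_step (p j) (p (j + 1))" "blue_step (p (j + 1)) (p (j + 2))" "red_step (p (j + 2)) (p (j + 3))"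
    "blue_step (p (j + 3)) (p (j + 4))"
    using j r step[of j] step[of "j + 1"] step[of "j + 2"] step[of "j + 3"] by (auto simp: numeral_eq_Suc)
  have x: "xc (p (j + 1)) = xc (p j) + 1 \<or> xc (p j) = xc (p (j + 1)) + 1" "xc (p (j + 2)) = xc (p (j + 1))"
    "xc (p (j + 3)) = xc (p (j + 2)) + 1 \<or> xc (p (j + 2)) = xc (p (j + 3)) + 1" "xc (p (j + 4)) = xc (p (j + 3))"
    using red_step_card(2)[OF s(1)] blue_step_card(1)[OF s(2)] red_step_card(2)[OF s(3)] blue_step_card(1)[OF s(4)]
    by auto
  show "xc (p (j + 4)) \<le> xc (p j) + 2" "xc (p j) \<le> xc (p (j + 4)) + 2"
    "xc (p (j + 4)) = xc (p j) + 2 \<Longrightarrow> xc (p (j + 1)) = xc (p j) + 1"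
    using x by linarith+
  show Y: "Ys (p (j + 1)) = Ys (p j)" using red_step_card(1)[OF s(1)] by simp
  show "Ys (p (j + 4)) = Ys (p j)" if "xc (p j) \<ge> 3 \<or> xc (p (j + 4)) \<ge> 3"
  proof -
    have "odd (xc (p (j + 3)))" using x(1-3) odd(1) by presburger
    then have "Xs (p (j + 3)) \<noteq> {}" by auto
    moreover have "xc (p (j + 2)) \<ge> 2" using x that by linarith
    ultimately show ?thesis using four_steps_same_road[OF s(2-4)] Y odd by simp
  qed
qed

lemma walk_length_red_first:
  assumes w: "walk L p red" and q: "q < 4" "Suc q < L" "red q" "odd (xc (p q))" "odd (yc (p q))"
  shows "L \<le> 14 * k"
proof -
  \<comment> \<open>The number of indices \<open>q, q + 4, q + 8, ...\<close> below
    \<open>L\<close>.\<close>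
  define N where "N = (L - q + 3) div 4"
  have N: "t < N \<longleftrightarrow> q + 4 * t < L" for t unfolding N_def using q(2) by presburger
  have parity: "odd (xc (p (q + 4 * t)))" "odd (yc (p (q + 4 * t)))" if "t < N" for t
  proof -
    have "q + 4 * t < L" using that N by blast
    moreover have "(q + 4 * t) div 2 = q div 2 + 2 * t" "(q + 4 * t + 1) div 2 = (q + 1) div 2 + 2 * t" by presburger+
    ultimately show "odd (xc (p (q + 4 * t)))" "odd (yc (p (q + 4 * t)))"
      using walk_parity(1,2)[OF w, of q] walk_parity(1,2)[OF w, of "q + 4 * t"] q by (auto split: if_splits)
  qed
  have red: "red (q + 4 * t)" if "Suc (q + 4 * t) < L" for t
  proof -
    have "red q \<longleftrightarrow> (even q \<longleftrightarrow> red 0)" "red (q + 4 * t) \<longleftrightarrow> (even (q + 4 * t) \<longleftrightarrow> red 0)"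
      by (rule walk_parity(3)[OF w]; use q(2) that in simp)+
    then show ?thesis using q(3) by (metis even_add even_mult_iff even_numeral)
  qed
  define d where "d t = xc (p (q + 4 * t))" for t
  define Z where "Z t = Ys (p (q + 4 * t))" for t
  \<comment> \<open>\<open>D\<close> bounds \<open>|X|\<close> for every face, and
    \<open>2 * E + 1\<close> is the largest odd number up to \<open>D\<close>.\<close>
  define D where "D = (3 * k + 1) div 2"
  define E where "E = (D - 1) div 2"
  have D: "xc P \<le> D" for P using card_Xs_le[of P] by (simp add: D_def n_def)
  have same: "Xs P = Xs P'" if "Ys P = Ys P'" "odd (yc P)" "xc P = xc P'" "xc P > 0" for P P'
    using Xs_determined[of P P'] that by (metis card.empty less_irrefl)
  have odd: "odd (d t)" if "t < N" for t using parity that by (simp add: d_def)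
  have inj: "Z s \<noteq> Z t" if "s < t" "t < N" "d s = d t" for s t
  proof
    assume Z: "Z s = Z t"
    have "d s > 0" using odd[of s] that by (cases "d s") auto
    then have "Xs (p (q + 4 * s)) = Xs (p (q + 4 * t))"
      using same Z that parity[of s] by (simp add: d_def Z_def)
    moreover have "q + 4 * s < q + 4 * t" "q + 4 * t < L" using that N by auto
    ultimately show False using walk_distinct[OF w] Z unfolding Z_def by blast
  qed
  have step: "Z (Suc t) = Z t \<and> d (Suc t) \<le> d t + 2 \<and> d t \<le> d (Suc t) + 2"
    if "Suc t < N" "d t \<ge> 3 \<or> d (Suc t) \<ge> 3" for t
    using walk_block[OF w, of "q + 4 * t"] that N[of "Suc t"] red[of t] parity[of t] parity[of "Suc t"]
    by (simp add: d_def Z_def add.commute add.left_commute)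
  have max: "d t \<le> 2 * E + 1" if "t < N" for t
    using D[of "p (q + 4 * t)"] odd[OF that] unfolding d_def E_def by presburger
  have base: "card (Z ` {t. t < N \<and> d t = 1}) \<le> 2 * k"
  proof -
    have "Z ` {t. t < N \<and> d t = 1} \<subseteq> (\<lambda>i. W (2 * i + 1)) ` {0..<2 * int k}"
    proof (rule image_subsetI)
      fix t assume "t \<in> {t. t < N \<and> d t = 1}"
      then have t: "t < N" "Xs (p (q + 4 * t)) \<noteq> {}" by (auto simp: d_def)
      then obtain r u where ru: "r > 1" "0 < u" "u \<le> 2 * of_int n" "p (q + 4 * t) = pt r u"
        using visible_pt by blast
      have oddY: "odd (yc (pt r u))" using parity(2)[OF t(1)] ru(4) by simp
      then obtain i where "0 \<le> i" "i < 2 * int k" "Ys (pt r u) = W (2 * i + 1)"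
        using odd_Ys_cell[OF ru(1-3) oddY] by metis
      then show "Z t \<in> (\<lambda>i. W (2 * i + 1)) ` {0..<2 * int k}"
        unfolding Z_def ru(4) by (intro image_eqI[of _ _ i]) simp_all
    qed
    then have "card (Z ` {t. t < N \<and> d t = 1}) \<le> card ((\<lambda>i. W (2 * i + 1)) ` {0..<2 * int k})"
      by (intro card_mono) simp_all
    also have "\<dots> \<le> card {0..<2 * int k}" by (rule card_image_le) simp
    finally show ?thesis by simp
  qed
  note comb = comb_walk_length[of N d Z E "2 * k", OF odd inj step max base]
  have L: "L \<le> q + 4 * N" using N[of N] by simp
  have parityk: "D = 2 * E + 1 \<and> 4 * E + 1 = 3 * k \<or> D = 2 * E + 2 \<and> 4 * E + 3 = 3 * k"
    using odd_k unfolding E_def D_def by presburger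
  \<comment> \<open>With \<open>q \<le> 3\<close> and \<open>L \<le> q + 4 * N\<close> the comb
    bound gives at most \<open>14k - 3\<close>, except when \<open>D\<close> is odd and
    \<open>N\<close> is maximal, where it only gives \<open>14k + 1\<close>.\<close>
  show ?thesis
  proof (cases "D = 2 * E + 1 \<and> N = 2 * k + 2 * E")
    case False
    then show ?thesis using comb(1) parityk L q(1) by linarith
  next
    case True
    have E: "4 * E + 1 = 3 * k" using True parityk by linarith
    then have "E \<ge> 1" using k_pos by (cases E) auto
    then obtain t where t: "N = Suc (Suc t)" "d t + 2 = 2 * E + 1" "d (Suc t) = 2 * E + 1" "Z t = Z (Suc t)"
      using comb(2) True by blast
    define j where "j = q + 4 * t"
    have j: "j + 4 < L" using N[of "Suc t"] t(1) by (simp add: j_def)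
    have dj: "xc (p j) + 2 = 2 * E + 1" "xc (p (j + 4)) = 2 * E + 1" "Ys (p j) = Ys (p (j + 4))"
      using t by (simp_all add: d_def Z_def j_def add.commute add.left_commute)
    have odds: "odd (xc (p j))" "odd (yc (p j))" "odd (yc (p (j + 4)))"
      using parity[of t] parity[of "Suc t"] t(1) by (simp_all add: j_def add.commute add.left_commute)
    have rj: "red j" "j + 5 < L \<Longrightarrow> red (j + 4)"
      using red[of t] red[of "Suc t"] j by (simp_all add: j_def add.commute add.left_commute)
    \<comment> \<open>Face \<open>j + 4\<close> has the maximal \<open>|X|\<close>, so a further red
      step would lower it to \<open>2 * E\<close> with the same \<open>Ys\<close>. That face was
      already visited at \<open>j + 1\<close>. This saves three faces and leaves
      \<open>14k - 2\<close>.\<close>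
    have "L \<le> j + 5"
    proof (rule ccontr)
      assume "\<not> L \<le> j + 5"
      then have "j + 5 < L" by simp
      moreover have "Suc (j + 4) = j + 5" by simp
      ultimately have "red_step (p (j + 4)) (p (j + 5))"
        using walk_step(1)[OF w, of "j + 4"] rj(2) by metis
      then have 1: "Ys (p (j + 5)) = Ys (p j)" "xc (p (j + 5)) = 2 * E"
        using red_step_card[of "p (j + 4)" "p (j + 5)"] dj D[of "p (j + 5)"] True by auto
      have 2: "Ys (p (j + 1)) = Ys (p j)" "xc (p (j + 1)) = 2 * E"
        using walk_block(4,5)[OF w j rj(1) odds] dj by auto
      have "Xs (p (j + 1)) = Xs (p (j + 5))"
        using same[of "p (j + 1)" "p (j + 5)"] 1 2 odds \<open>E \<ge> 1\<close> by simp
      then show False using walk_distinct[OF w, of "j + 1" "j + 5"] 1 2 \<open>j + 5 < L\<close> by simp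
    qed
    then show ?thesis using E True t(1) q(1) by (simp add: j_def)
  qed
qed

text \<open>If a face with both counts odd is followed by a blue step, then every such face other
  than the first of the walk is entered by a red one. Reversing the walk gives the case already
  treated.\<close>

lemma walk_length:
  assumes w: "walk L p red"
  shows "L \<le> 14 * k"
proof (rule ccontr)
  assume "\<not> L \<le> 14 * k"
  then have L: "L > 14" using k_pos by simp
  have ex: "\<exists>q<4. odd (xc (p q)) \<and> odd (yc (p q))" if "walk L p red" for p red
  proof -
    obtain q where q: "q < 4"
      "odd (xc (p 0) + (if red 0 then (q + 1) div 2 else q div 2))"
      "odd (yc (p 0) + (if red 0 then q div 2 else (q + 1) div 2))"
      using ex_odd_halves[of "xc (p 0)" "yc (p 0)"] ex_odd_halves[of "yc (p 0)" "xc (p 0)"]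
      by (cases "red 0") (auto simp del: even_add)
    then have "q < L" using L by simp
    then show ?thesis using walk_parity(1,2)[OF that, of q] q by blast
  qed
  obtain q where q: "q < 4" "odd (xc (p q))" "odd (yc (p q))" using ex[OF w] by blast
  show False
  proof (cases "red q")
    case True
    then show ?thesis using walk_length_red_first[OF w, of q] q L \<open>\<not> L \<le> 14 * k\<close> by auto
  next
    case False
    define p' where "p' = (\<lambda>j. p (L - 1 - j))"
    define red' where "red' = (\<lambda>j. red (L - 2 - j))"
    have w': "walk L p' red'" using walk_rev[OF w] by (simp add: p'_def red'_def)
    obtain q' where q': "q' < 4" "odd (xc (p' q'))" "odd (yc (p' q'))" using ex[OF w'] by blast
    define i where "i = L - 2 - q'"
    have i: "L - 1 - q' = Suc i" "Suc i < L" "L - 2 - q' = i" using q'(1) L by (auto simp: i_def)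
    have "odd (xc (p (Suc i)))" "odd (yc (p (Suc i)))" using q' i by (simp_all add: p'_def)
    moreover have "q < L" using q(1) L by simp
    \<comment> \<open>Faces with both counts odd occur only at indices of one parity, so the colour
      before one of them is determined by the colour after another.\<close>
    ultimately have "(even ((Suc i + 1) div 2) \<longleftrightarrow> even ((q + 1) div 2)) \<and> (even (Suc i div 2) \<longleftrightarrow> even (q div 2))"
      using walk_parity(1,2)[OF w i(2)] walk_parity(1,2)[OF w, of q] q
      by (cases "red 0") (simp_all only: even_add if_True if_False, blast+)
    then have "even (Suc i) \<longleftrightarrow> even q" using even_iff_half_parities by blast
    moreover have "red q \<longleftrightarrow> (even q \<longleftrightarrow> red 0)" "red i \<longleftrightarrow> (even i \<longleftrightarrow> red 0)"
      by (rule walk_parity(3)[OF w]; use i(2) q(1) L in simp)+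
    ultimately have "red i" using False by (metis even_Suc)
    then have "red' q'" using i by (simp add: red'_def)
    then show ?thesis using walk_length_red_first[OF w', of q'] q' L \<open>\<not> L \<le> 14 * k\<close> by auto
  qed
qed

section \<open>Colouring, numbers of lines, and the bound for dual paths\<close>

definition colour :: "plane set \<Rightarrow> color" where
  "colour l = (if l \<in> line ` Inl ` {0..<n} then Red else Blue)"

lemma colour_line: "x \<in> idx \<Longrightarrow> colour (line x) = Red \<longleftrightarrow> isl x"
proof -
  assume x: "x \<in> idx"
  have "line x \<in> line ` Inl ` {0..<n} \<longleftrightarrow> x \<in> Inl ` {0..<n}"
    by (rule inj_on_image_mem_iff[OF inj_on_line x]) (simp add: idx_def)
  then show ?thesis using x by (auto simp: colour_def idx_def)
qed

lemma card_lines: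
  "card (line ` idx) = 5 * k"
  "card {l \<in> line ` idx. colour l = Red} = 3 * k"
  "card {l \<in> line ` idx. colour l = Blue} = 2 * k"
proof -
  have R: "{l \<in> line ` idx. colour l = Red} = line ` Inl ` {0..<n}"
    using colour_line by (auto simp: idx_def)
  have B: "{l \<in> line ` idx. colour l = Blue} = line ` Inr ` {0..<2 * int k}"
  proof -
    have "colour l = Blue \<longleftrightarrow> colour l \<noteq> Red" for l by (cases "colour l") auto
    then show ?thesis using colour_line by (auto simp: idx_def)
  qed
  have inj: "inj_on line (Inl ` {0..<n})" "inj_on line (Inr ` {0..<2 * int k})"
    using inj_on_line by (auto simp: idx_def inj_on_Un)
  have c: "card (Inl ` {0..<n} :: (int + int) set) = 3 * k" "card (Inr ` {0..<2 * int k} :: (int + int) set) = 2 * k"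
    by (simp_all add: card_image n_def nat_mult_distrib)
  show "card {l \<in> line ` idx. colour l = Red} = 3 * k" "card {l \<in> line ` idx. colour l = Blue} = 2 * k"
    unfolding R B using inj c by (simp_all add: card_image)
  have "card idx = card (Inl ` {0..<n} :: (int + int) set) + card (Inr ` {0..<2 * int k} :: (int + int) set)"
    unfolding idx_def by (rule card_Un_disjoint) auto
  then show "card (line ` idx) = 5 * k" using card_image[OF inj_on_line] c by simp
qed

lemma alternating_dual_path_length:
  assumes "alternating_dual_path colour (line ` idx) fs"
  shows "length fs \<le> 14 * k"
proof -
  have fin: "finite idx" by (simp add: idx_def)
  show ?thesis
  proof (rule alternating_dual_path_crossings[where a = normal and b = offset, folded line_def,
        OF fin inj_on_line refl assms])
    fix p w
    assume diff: "\<And>i j. i < j \<Longrightarrow> j < length fs \<Longrightarrow>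
        pos_set idx normal offset (p i) \<noteq> pos_set idx normal offset (p j)"
      and cross: "\<And>j. Suc j < length fs \<Longrightarrow> crossing idx normal offset (w j) (p j) (p (Suc j))"
      and alt: "\<And>j. Suc (Suc j) < length fs \<Longrightarrow> colour (line (w j)) \<noteq> colour (line (w (Suc j)))"
    have w: "w j \<in> idx" if "Suc j < length fs" for j using cross[OF that] by (simp add: crossing_def)
    have "walk (length fs) p (\<lambda>j. isl (w j))"
      unfolding walk_def
    proof (intro conjI allI impI)
      show "Xs (p i) \<noteq> Xs (p j) \<or> Ys (p i) \<noteq> Ys (p j)" if "i < j" "j < length fs" for i j
        using diff[OF that] by (simp add: pos_set_eq_iff)
      show "if isl (w j) then red_step (p j) (p (Suc j)) else blue_step (p j) (p (Suc j))"
        if "Suc j < length fs" for j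
        using cross[OF that] crossing_red_step crossing_blue_step by (cases "w j") auto
      show "isl (w j) \<noteq> isl (w (Suc j))" if "Suc (Suc j) < length fs" for j
        using alt[OF that] colour_line[OF w[of j]] colour_line[OF w[of "Suc j"]] that
        by (cases "colour (line (w j))"; cases "colour (line (w (Suc j)))") auto
    qed
    then show ?thesis by (rule walk_length)
  qed
qed

end

theorem theorem2:
  fixes k :: nat
  assumes "odd k" and "k > 0"
  shows "\<exists>(A :: plane set set) (c :: plane set \<Rightarrow> color).
           simple_arrangement A \<and> card A = 5 * k \<and>
           card {l \<in> A. c l = Red} = 3 * k \<and>
           card {l \<in> A. c l = Blue} = 2 * k \<and>
           (\<forall>fs. alternating_dual_path c A fs \<longrightarrow> length fs \<le> 14 * k)"
proof -
  interpret pinwheel k by standard (rule assms(1))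
  show ?thesis
    using simple_arrangement_lines card_lines alternating_dual_path_length by blast
qed

end
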